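(* Let $n\ge 1$. The assignment $$e_i \mapsto \psi_{i}\psi_{i+1}^{\dagger},\quad f_i \mapsto \psi_{i+1}\psi_i^{\dagger},\quad k_i\mapsto v_i v_{i+1}^{-1}\qquad (i=1,2,\dots,n-1),$$ $$e_n \mapsto \sqrt{-1}\,(q^{1/2}-q^{-1/2})^{-1}\psi_n,\quad f_n\mapsto \psi_n^{\dagger},\quad k_n\mapsto \sqrt{-1}\, q^{1/2}v_n$$ defines a $\mathbb{C}(q^{1/2})$-linear map $\pi: \mathrm{U}_q(\mathfrak{osp}(1|2n),\Theta_1)\to \mathrm{Cl}_q(n)$ which is an associative superalgebra homomorphism.
   Context: $q$ is an indeterminate over $\mathbb{C}$; all algebras are over $\mathbb{C}(q^{1/2})$; $\sqrt{-1}\in\mathbb{C}$ is the imaginary unit. For a superalgebra, $[x]\in\mathbb{Z}_2$ denotes the parity of a homogeneous element $x$. **The quantum supergroup $\mathrm{U}_q(\mathfrak{osp}(1|2n),\Theta_1)$, $\Theta_1=\{n\}$.** Let $A=(a_{ij})_{1\le i,j\le n}$ be given by $a_{ii}=2$; $a_{i,i+1}=-1$ for $1\le i\le n-1$; $a_{i+1,i}=-1$ for $1\le i\le n-2$; $a_{n,n-1}=-2$ (if $n\geq 2$); all other entries $0$. Let $d_i=1$ for $i<n$, $d_n=\tfrac12$, and $q_i=q^{d_i}$. $\mathrm{U}_q(\mathfrak{osp}(1|2n),\Theta_1)$ is the associative superalgebra generated by $e_i,f_i,k_i^{\pm1}$ ($1\le i\le n$), with $e_n,f_n$ odd and all other generators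 even, subject to - $k_ik_i^{-1}=k_i^{-1}k_i=1$, $k_ik_j=k_jk_i$; - $k_ie_jk_i^{-1}=q_i^{a_{ij}}e_j$, $k_if_jk_i^{-1}=q_i^{-a_{ij}}f_j$; - $e_if_j-(-1)^{[e_i][f_j]}f_je_i=\delta_{ij}\dfrac{k_i-k_i^{-1}}{q-q^{-1}}$; - $(\mathrm{Ad}_{e_i})^{1-a_{ij}}(e_j)=(\mathrm{Ad}_{f_i})^{1-a_{ij}}(f_j)=0$ for $i\ne j$, where, for homogeneous $x$, $\mathrm{Ad}_{e_i}(x)=e_ix-(-1)^{[e_i][x]}k_ixk_i^{-1}e_i$ and $\mathrm{Ad}_{f_i}(x)=f_ix-(-1)^{[f_i][x]}k_i^{-1}xk_if_i$. **The deformed Clifford algebra $\mathrm{Cl}_q(n)$** is the associative superalgebra generated by $\psi_i,\psi_i^\dagger,v_i^{\pm1}$ ($1\le i\le n$), with $\psi_i,\psi_i^\dagger$ odd and $v_i^{\pm 1}$ even, subject to - $v_iv_j=v_jv_i$, $v_iv_i^{-1}=v_i^{-1}v_i=1$; - $v_i\psi_jv_i^{-1}=q^{\delta_{ij}}\psi_j$, $v_i\psi_j^\dagger v_i^{-1}=q^{-\delta_{ij}}\psi_j^\dagger$; - $\psi_i\psi_j+\psi_j\psi_i=\psi_i^\dagger\psi_j^\dagger+\psi_j^\dagger\psi_i^\dagger=0$ for all $i,j$; - $\psi_i\psi_j^\dagger+\psi_j^\dagger\psi_i=0$ for $i\ne j$; - $\psi_i\psi_i^\dagger+q\psi_i^\dagger\psi_i=v_i^{-1}$,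 $\psi_i\psi_i^\dagger+q^{-1}\psi_i^\dagger\psi_i=v_i$. *)

theory Defs
  imports
    "HOL-Algebra.Algebra"
    "HOL-Algebra.Algebraic_Closure_Type"
    "HOL-Library.Poly_Mapping"
    "HOL-Library.Z2"
begin

section \<open>The ground field\<close>

text \<open>The field of rational functions over the complex numbers in one indeterminate; the
  indeterminate is \<open>q\<^sup>1\<^sup>/\<^sup>2\<close>, written \<open>qh\<close>.\<close>

type_synonym ratfun = "complex poly fract"

abbreviation ground_field :: "ratfun ring" where
  "ground_field \<equiv> ring_of_type_algebra"

definition qh :: ratfun where
  "qh = Fract [:0, 1:] 1"

definition qq :: ratfun where
  "qq = qh ^ 2"

definition imag_unit :: ratfun where
  "imag_unit = Fract [:\<i>:] 1"


section \<open>Associative superalgebras\<close>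

text \<open>The grading group is the type \<^typ>\<open>bit\<close> of integers modulo 2. All
  algebras are unital, not necessarily commutative (so the library locale \<open>algebra\<close> does not
  apply).\<close>

record ('a, 'b) superalgebra = "('a, 'b) module" +
  component :: "bit \<Rightarrow> 'b set"

locale superalgebra = module R A + ring A
  for R :: "('a, 'm) ring_scheme" (structure) and A :: "('a, 'b, 'n) superalgebra_scheme" (structure) +
  assumes smult_mult_left:
      "\<lbrakk>c \<in> carrier R; x \<in> carrier A; y \<in> carrier A\<rbrakk> \<Longrightarrow>
        (c \<odot>\<^bsub>A\<^esub> x) \<otimes>\<^bsub>A\<^esub> y = c \<odot>\<^bsub>A\<^esub> (x \<otimes>\<^bsub>A\<^esub> y)"
    and smult_mult_right:
      "\<lbrakk>c \<in> carrier R; x \<in> carrier A; y \<in> carrier A\<rbrakk> \<Longrightarrow>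
        x \<otimes>\<^bsub>A\<^esub> (c \<odot>\<^bsub>A\<^esub> y) = c \<odot>\<^bsub>A\<^esub> (x \<otimes>\<^bsub>A\<^esub> y)"
    and component_submodule: "submodule (component A s) R A"
    and component_sum: "component A 0 <+>\<^bsub>A\<^esub> component A 1 = carrier A"
    and component_disjoint: "component A 0 \<inter> component A 1 = {\<zero>\<^bsub>A\<^esub>}"
    and component_mult:
      "\<lbrakk>x \<in> component A s; y \<in> component A t\<rbrakk> \<Longrightarrow> x \<otimes>\<^bsub>A\<^esub> y \<in> component A (s + t)"

locale superalgebra_hom = dom: superalgebra R A + cod: superalgebra R B
  for R :: "('a, 'm) ring_scheme" (structure)
    and A :: "('a, 'b, 'n) superalgebra_scheme" (structure)
    and B :: "('a, 'c, 'p) superalgebra_scheme" (structure) +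
  fixes h :: "'b \<Rightarrow> 'c"
  assumes ring_hom: "h \<in> ring_hom A B"
    and linear: "\<lbrakk>c \<in> carrier R; x \<in> carrier A\<rbrakk> \<Longrightarrow> h (c \<odot>\<^bsub>A\<^esub> x) = c \<odot>\<^bsub>B\<^esub> h x"
    and preserves_parity: "x \<in> component A s \<Longrightarrow> h x \<in> component B s"

text \<open>The parity of a nonzero homogeneous element. The zero element lies in both components; the
  value chosen for it plays no role below.\<close>

definition parity :: "('a, 'b, 'm) superalgebra_scheme \<Rightarrow> 'b \<Rightarrow> bit" where
  "parity A x = (if x \<in> component A 1 then 1 else 0)"

text \<open>The sign \<open>(-1)\<^bsup>st\<^esup>\<close>.\<close>

definition koszul_sign :: "bit \<Rightarrow> bit \<Rightarrow> 'a::ring_1" where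
  "koszul_sign s t = (if s * t = 1 then - 1 else 1)"


section \<open>Presentations\<close>

text \<open>The free monoid, written additively so that finitely supported functions on it carry the
  convolution product of \<^theory>\<open>HOL-Library.Poly_Mapping\<close>, i.e. form the free algebra.\<close>

datatype 'g fword = FWord (letters: "'g list")

instantiation fword :: (type) monoid_add
begin

definition zero_fword :: "'a fword" where
  "zero_fword = FWord []"

definition plus_fword :: "'a fword \<Rightarrow> 'a fword \<Rightarrow> 'a fword" where
  "plus_fword u w = FWord (letters u @ letters w)"

instance
  by standard (simp_all add: zero_fword_def plus_fword_def)

end

type_synonym 'g free_alg = "'g fword \<Rightarrow>\<^sub>0 ratfun"

definition gen :: "'g \<Rightarrow> 'g free_alg" where
  "gen g = Poly_Mapping.single (FWord [g]) 1"

definition scal :: "ratfun \<Rightarrow> 'g free_alg" where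
  "scal c = Poly_Mapping.single 0 c"

definition word_parity :: "('g \<Rightarrow> bit) \<Rightarrow> 'g fword \<Rightarrow> bit" where
  "word_parity p w = sum_list (map p (letters w))"

definition free_carrier :: "'g set \<Rightarrow> 'g free_alg set" where
  "free_carrier G = {a. \<forall>w \<in> Poly_Mapping.keys a. set (letters w) \<subseteq> G}"

text \<open>The free superalgebra on the set \<open>G\<close>, where the generator \<open>g\<close> has parity \<open>p g\<close>.\<close>

definition free_superalgebra ::
  "'g set \<Rightarrow> ('g \<Rightarrow> bit) \<Rightarrow> (ratfun, 'g free_alg) superalgebra" where
  "free_superalgebra G p =
    \<lparr>carrier = free_carrier G, monoid.mult = (*), one = 1, ring.zero = 0, add = (+),
     module.smult = (\<lambda>c a. scal c * a),
     component = (\<lambda>s. {a \<in> free_carrier G. \<forall>w \<in> Poly_Mapping.keys a. word_parity p w = s})\<rparr>"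

text \<open>The quotient of a superalgebra by a two-sided ideal generated by homogeneous elements.\<close>

definition quotient_superalgebra ::
  "('a, 'b, 'm) superalgebra_scheme \<Rightarrow> 'b set \<Rightarrow> ('a, 'b set) superalgebra" where
  "quotient_superalgebra A I =
    \<lparr>carrier = carrier (A Quot I), monoid.mult = monoid.mult (A Quot I),
     one = one (A Quot I), ring.zero = ring.zero (A Quot I), add = add (A Quot I),
     module.smult = (\<lambda>c C. \<Union>x\<in>C. I +>\<^bsub>A\<^esub> (c \<odot>\<^bsub>A\<^esub> x)),
     component = (\<lambda>s. (\<lambda>x. I +>\<^bsub>A\<^esub> x) ` component A s)\<rparr>"


section \<open>The quantum supergroup of osp(1|2n)\<close>

text \<open>\<open>UK' i\<close> stands for the inverse of \<open>UK i\<close>.\<close>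

datatype ugen = UE nat | UF nat | UK nat | UK' nat

definition ugens :: "nat \<Rightarrow> ugen set" where
  "ugens n = UE ` {1..n} \<union> UF ` {1..n} \<union> UK ` {1..n} \<union> UK' ` {1..n}"

fun upar :: "nat \<Rightarrow> ugen \<Rightarrow> bit" where
  "upar n (UE i) = (if i = n then 1 else 0)"
| "upar n (UF i) = (if i = n then 1 else 0)"
| "upar n (UK i) = 0"
| "upar n (UK' i) = 0"

definition cartan :: "nat \<Rightarrow> nat \<Rightarrow> nat \<Rightarrow> int" where
  "cartan n i j =
    (if i = j then 2
     else if j = i + 1 then - 1
     else if i = j + 1 then (if i = n then - 2 else - 1)
     else 0)"

text \<open>\<open>q\<^sub>i = q\<^bsup>d\<^sub>i\<^esup>\<close> with \<open>d\<^sub>i = 1\<close> for \<open>i < n\<close> and \<open>d\<^sub>n = 1/2\<close>.\<close>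

definition qi :: "nat \<Rightarrow> nat \<Rightarrow> ratfun" where
  "qi n i = (if i < n then qq else qh)"

abbreviation ufree :: "nat \<Rightarrow> (ratfun, ugen free_alg) superalgebra" where
  "ufree n \<equiv> free_superalgebra (ugens n) (upar n)"

text \<open>Both operators are only meaningful on homogeneous \<open>x\<close>.\<close>

definition Ad_e :: "nat \<Rightarrow> nat \<Rightarrow> ugen free_alg \<Rightarrow> ugen free_alg" where
  "Ad_e n i x =
    gen (UE i) * x
    - koszul_sign (parity (ufree n) (gen (UE i))) (parity (ufree n) x)
      * (gen (UK i) * x * gen (UK' i) * gen (UE i))"

definition Ad_f :: "nat \<Rightarrow> nat \<Rightarrow> ugen free_alg \<Rightarrow> ugen free_alg" where
  "Ad_f n i x =
    gen (UF i) * x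
    - koszul_sign (parity (ufree n) (gen (UF i))) (parity (ufree n) x)
      * (gen (UK' i) * x * gen (UK i) * gen (UF i))"

text \<open>A relation \<open>l = r\<close> is represented by the element \<open>l - r\<close> of the free superalgebra.\<close>

inductive_set urels :: "nat \<Rightarrow> ugen free_alg set" for n :: nat where
  K_inv1: "i \<in> {1..n} \<Longrightarrow> gen (UK i) * gen (UK' i) - 1 \<in> urels n"
| K_inv2: "i \<in> {1..n} \<Longrightarrow> gen (UK' i) * gen (UK i) - 1 \<in> urels n"
| K_comm: "\<lbrakk>i \<in> {1..n}; j \<in> {1..n}\<rbrakk> \<Longrightarrow>
    gen (UK i) * gen (UK j) - gen (UK j) * gen (UK i) \<in> urels n"
| K_E: "\<lbrakk>i \<in> {1..n}; j \<in> {1..n}\<rbrakk> \<Longrightarrow>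
    gen (UK i) * gen (UE j) * gen (UK' i)
      - scal (qi n i powi cartan n i j) * gen (UE j) \<in> urels n"
| K_F: "\<lbrakk>i \<in> {1..n}; j \<in> {1..n}\<rbrakk> \<Longrightarrow>
    gen (UK i) * gen (UF j) * gen (UK' i)
      - scal (qi n i powi (- cartan n i j)) * gen (UF j) \<in> urels n"
| E_F: "\<lbrakk>i \<in> {1..n}; j \<in> {1..n}\<rbrakk> \<Longrightarrow>
    gen (UE i) * gen (UF j)
      - koszul_sign (parity (ufree n) (gen (UE i))) (parity (ufree n) (gen (UF j)))
        * (gen (UF j) * gen (UE i))
      - (if i = j then scal (1 / (qq - inverse qq)) * (gen (UK i) - gen (UK' i)) else 0)
      \<in> urels n"
| Serre_E: "\<lbrakk>i \<in> {1..n}; j \<in> {1..n}; i \<noteq> j\<rbrakk> \<Longrightarrow>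
    (Ad_e n i ^^ nat (1 - cartan n i j)) (gen (UE j)) \<in> urels n"
| Serre_F: "\<lbrakk>i \<in> {1..n}; j \<in> {1..n}; i \<noteq> j\<rbrakk> \<Longrightarrow>
    (Ad_f n i ^^ nat (1 - cartan n i j)) (gen (UF j)) \<in> urels n"

definition uideal :: "nat \<Rightarrow> ugen free_alg set" where
  "uideal n = genideal (ufree n) (urels n)"

definition Uq_osp :: "nat \<Rightarrow> (ratfun, ugen free_alg set) superalgebra" where
  "Uq_osp n = quotient_superalgebra (ufree n) (uideal n)"

definition e_gen :: "nat \<Rightarrow> nat \<Rightarrow> ugen free_alg set" where
  "e_gen n i = uideal n +>\<^bsub>ufree n\<^esub> gen (UE i)"

definition f_gen :: "nat \<Rightarrow> nat \<Rightarrow> ugen free_alg set" where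
  "f_gen n i = uideal n +>\<^bsub>ufree n\<^esub> gen (UF i)"

definition k_gen :: "nat \<Rightarrow> nat \<Rightarrow> ugen free_alg set" where
  "k_gen n i = uideal n +>\<^bsub>ufree n\<^esub> gen (UK i)"


section \<open>The deformed Clifford algebra\<close>

text \<open>\<open>Psi\<close>, \<open>PsiD\<close>, \<open>V\<close>, \<open>V'\<close> stand for \<open>\<psi>\<close>, \<open>\<psi>\<^sup>\<dagger>\<close>, \<open>v\<close> and the inverse of \<open>v\<close>.\<close>

datatype cgen = Psi nat | PsiD nat | V nat | V' nat

definition cgens :: "nat \<Rightarrow> cgen set" where
  "cgens n = Psi ` {1..n} \<union> PsiD ` {1..n} \<union> V ` {1..n} \<union> V' ` {1..n}"

fun cpar :: "cgen \<Rightarrow> bit" where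
  "cpar (Psi i) = 1"
| "cpar (PsiD i) = 1"
| "cpar (V i) = 0"
| "cpar (V' i) = 0"

abbreviation cfree :: "nat \<Rightarrow> (ratfun, cgen free_alg) superalgebra" where
  "cfree n \<equiv> free_superalgebra (cgens n) cpar"

inductive_set crels :: "nat \<Rightarrow> cgen free_alg set" for n :: nat where
  V_comm: "\<lbrakk>i \<in> {1..n}; j \<in> {1..n}\<rbrakk> \<Longrightarrow>
    gen (V i) * gen (V j) - gen (V j) * gen (V i) \<in> crels n"
| V_inv1: "i \<in> {1..n} \<Longrightarrow> gen (V i) * gen (V' i) - 1 \<in> crels n"
| V_inv2: "i \<in> {1..n} \<Longrightarrow> gen (V' i) * gen (V i) - 1 \<in> crels n"
| V_Psi: "\<lbrakk>i \<in> {1..n}; j \<in> {1..n}\<rbrakk> \<Longrightarrow>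
    gen (V i) * gen (Psi j) * gen (V' i)
      - scal (qq powi (if i = j then 1 else 0)) * gen (Psi j) \<in> crels n"
| V_PsiD: "\<lbrakk>i \<in> {1..n}; j \<in> {1..n}\<rbrakk> \<Longrightarrow>
    gen (V i) * gen (PsiD j) * gen (V' i)
      - scal (qq powi (- (if i = j then 1 else 0))) * gen (PsiD j) \<in> crels n"
| Psi_Psi: "\<lbrakk>i \<in> {1..n}; j \<in> {1..n}\<rbrakk> \<Longrightarrow>
    gen (Psi i) * gen (Psi j) + gen (Psi j) * gen (Psi i) \<in> crels n"
| PsiD_PsiD: "\<lbrakk>i \<in> {1..n}; j \<in> {1..n}\<rbrakk> \<Longrightarrow>
    gen (PsiD i) * gen (PsiD j) + gen (PsiD j) * gen (PsiD i) \<in> crels n"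
| Psi_PsiD: "\<lbrakk>i \<in> {1..n}; j \<in> {1..n}; i \<noteq> j\<rbrakk> \<Longrightarrow>
    gen (Psi i) * gen (PsiD j) + gen (PsiD j) * gen (Psi i) \<in> crels n"
| Psi_PsiD_q: "i \<in> {1..n} \<Longrightarrow>
    gen (Psi i) * gen (PsiD i) + scal qq * (gen (PsiD i) * gen (Psi i)) - gen (V' i) \<in> crels n"
| Psi_PsiD_q_inv: "i \<in> {1..n} \<Longrightarrow>
    gen (Psi i) * gen (PsiD i) + scal (inverse qq) * (gen (PsiD i) * gen (Psi i)) - gen (V i)
      \<in> crels n"

definition cideal :: "nat \<Rightarrow> cgen free_alg set" where
  "cideal n = genideal (cfree n) (crels n)"

definition Clq :: "nat \<Rightarrow> (ratfun, cgen free_alg set) superalgebra" where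
  "Clq n = quotient_superalgebra (cfree n) (cideal n)"

definition psi :: "nat \<Rightarrow> nat \<Rightarrow> cgen free_alg set" where
  "psi n i = cideal n +>\<^bsub>cfree n\<^esub> gen (Psi i)"

definition psi_dag :: "nat \<Rightarrow> nat \<Rightarrow> cgen free_alg set" where
  "psi_dag n i = cideal n +>\<^bsub>cfree n\<^esub> gen (PsiD i)"

definition v_gen :: "nat \<Rightarrow> nat \<Rightarrow> cgen free_alg set" where
  "v_gen n i = cideal n +>\<^bsub>cfree n\<^esub> gen (V i)"

definition v_inv :: "nat \<Rightarrow> nat \<Rightarrow> cgen free_alg set" where
  "v_inv n i = cideal n +>\<^bsub>cfree n\<^esub> gen (V' i)"

end

theory Submission
  imports Defs
begin

text \<open>Both algebras are quotients of free superalgebras by ideals that are generated by homogeneous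
  elements. Such an ideal splits into its even and its odd part, so the quotient inherits the
  grading (\<open>superalgebra_Q\<close>), and a homomorphism out of it is the same thing as a parity preserving
  assignment on the generators that kills the relations (\<open>quotient_universal\<close>, \<open>free_lift_hom\<close>).
  Uniqueness follows because the images of \<open>e\<^sub>i\<close>, \<open>f\<^sub>i\<close> and \<open>k\<^sub>i\<close> are prescribed and the
  image of \<open>k\<^sub>i\<close> determines that of its inverse (\<open>osp_hom_eqI\<close>). What remains is to verify the
  relations of the quantum supergroup for the proposed images (\<open>\<Phi>_relation\<close>).

  This verification rests on one observation: in the deformed Clifford algebra almost every pair of
  elements in sight commutes up to a scalar, \<open>x y = s y x\<close>, and this property is stable under
  products in either argument. Conjugation by \<open>k\<^sub>i\<close> is then a count of weights (\<open>k_conj\<close>,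
  \<open>root_pairing\<close>). For \<open>i \<noteq> j\<close> all letters of \<open>e\<^sub>i\<close> anticommute with all letters of
  \<open>f\<^sub>j\<close>, and at least one of these two elements has two letters, so they commute
  (\<open>qcomm_e_f\<close>). Only the relation between \<open>e\<^sub>i\<close> and \<open>f\<^sub>i\<close> goes beyond such counting: the two
  deformed relations between \<open>\<psi>\<^sub>i\<close> and \<open>\<psi>\<^sub>i\<^sup>\<dagger>\<close> express both \<open>\<psi>\<^sub>i \<psi>\<^sub>i\<^sup>\<dagger>\<close> and
  \<open>\<psi>\<^sub>i\<^sup>\<dagger> \<psi>\<^sub>i\<close> linearly in \<open>v\<^sub>i\<close> and its inverse, and the rest is a comparison of
  coefficients (\<open>e_f_inner\<close>, \<open>e_f_last\<close>).

  The Serre relations hold for a crude reason. Since \<open>k\<^sub>i\<close> acts on \<open>e\<^sub>i\<close> and \<open>e\<^sub>j\<close> by scalars,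
  a power of \<open>Ad\<close> applied to \<open>e\<^sub>j\<close> is a combination of words \<open>e\<^sub>i\<^sup>a e\<^sub>j e\<^sub>i\<^sup>b\<close>. The squares of the
  fermions vanish, hence \<open>e\<^sub>i\<^sup>2 = 0\<close>, and for \<open>i < n\<close> also \<open>e\<^sub>i e\<^sub>j e\<^sub>i = 0\<close>, because one of the
  two letters of \<open>e\<^sub>i\<close> commutes up to a scalar with \<open>e\<^sub>j\<close>. So every word that occurs in degree
  two for \<open>i < n\<close>, or in degree three for \<open>i = n\<close>, is zero, whatever the coefficients are
  (\<open>serre_two\<close>, \<open>serre_three\<close>).\<close>

section \<open>Quotients by homogeneous ideals\<close>

locale homogeneous_relations = superalgebra R A
  for R :: "('a, 'm) ring_scheme" (structure) and A :: "('a, 'b, 'n) superalgebra_scheme" (structure) +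
  fixes S :: "'b set"
  assumes homogeneous: "S \<subseteq> component A 0 \<union> component A 1"
begin

abbreviation I where "I \<equiv> genideal A S"
abbreviation Q where "Q \<equiv> quotient_superalgebra A I"

end

context superalgebra
begin

lemma component_subset: "component A s \<subseteq> carrier A"
  using submoduleE(1)[OF component_submodule] .

lemma component_closed [simp]: "x \<in> component A s \<Longrightarrow> x \<in> carrier A"
  using component_subset by blast

lemma component_zero: "\<zero>\<^bsub>A\<^esub> \<in> component A s"
proof -
  have "subgroup (component A s) (add_monoid A)"
    using component_submodule[of s] unfolding submodule_def by blast
  then show ?thesis using subgroup.one_closed by fastforce
qed

lemma component_add: "x \<in> component A s \<Longrightarrow> y \<in> component A s \<Longrightarrow> x \<oplus>\<^bsub>A\<^esub> y \<in> component A s"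
  using submoduleE(5)[OF component_submodule] .

lemma component_minus: "x \<in> component A s \<Longrightarrow> \<ominus>\<^bsub>A\<^esub> x \<in> component A s"
  using submoduleE(3)[OF component_submodule] .

lemma component_smult: "c \<in> carrier R \<Longrightarrow> x \<in> component A s \<Longrightarrow> c \<odot>\<^bsub>A\<^esub> x \<in> component A s"
  using submoduleE(4)[OF component_submodule] .

lemma homogeneous_decomposition:
  assumes "x \<in> carrier A"
  obtains a b where "a \<in> component A 0" "b \<in> component A 1" "x = a \<oplus>\<^bsub>A\<^esub> b"
  using assms unfolding component_sum[symmetric] set_add_def' by blast

end

context homogeneous_relations
begin

lemma gens_subset: "S \<subseteq> carrier A"
  using homogeneous component_subset by blast

lemma ideal_I: "ideal I A"
  using genideal_ideal[OF gens_subset] .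

lemma ideal_smult_closed:
  assumes "c \<in> carrier R" "x \<in> I" shows "c \<odot>\<^bsub>A\<^esub> x \<in> I"
proof -
  interpret I: ideal I A by (rule ideal_I)
  have x: "x \<in> carrier A" using assms I.Icarr by blast
  have "c \<odot>\<^bsub>A\<^esub> x = (c \<odot>\<^bsub>A\<^esub> \<one>\<^bsub>A\<^esub>) \<otimes>\<^bsub>A\<^esub> x"
    using assms x by (simp add: smult_mult_left)
  then show ?thesis using I.I_l_closed[OF assms(2)] assms(1) by simp
qed

text \<open>The elements of the ideal whose homogeneous parts lie again in the ideal form an ideal, by the
  multiplication rule for the components. It contains the generators, so it is everything.\<close>

lemma ideal_homogeneous:
  assumes "x \<in> I"
  shows "\<exists>a\<in>component A 0 \<inter> I. \<exists>b\<in>component A 1 \<inter> I. x = a \<oplus>\<^bsub>A\<^esub> b"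
proof -
  interpret I: ideal I A by (rule ideal_I)
  define J where "J = {a \<oplus>\<^bsub>A\<^esub> b | a b. a \<in> component A 0 \<inter> I \<and> b \<in> component A 1 \<inter> I}"
  have JI: "J \<subseteq> I" by (auto simp: J_def)
  have J_mem: "a \<oplus>\<^bsub>A\<^esub> b \<in> J" if "a \<in> component A 0" "a \<in> I" "b \<in> component A 1" "b \<in> I" for a b
    using that by (auto simp: J_def)
  have "ideal J A"
  proof (rule idealI)
    show "ring A" by (rule ring_axioms)
    show "subgroup J (add_monoid A)"
    proof (rule add.subgroupI)
      show "J \<subseteq> carrier A" using JI I.Icarr by blast
      show "J \<noteq> {}" using J_mem[of "\<zero>\<^bsub>A\<^esub>" "\<zero>\<^bsub>A\<^esub>"] component_zero by auto
      fix x assume "x \<in> J"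
      then obtain a b where ab: "a \<in> component A 0" "a \<in> I" "b \<in> component A 1" "b \<in> I"
        "x = a \<oplus>\<^bsub>A\<^esub> b" by (auto simp: J_def)
      have "\<ominus>\<^bsub>A\<^esub> x = (\<ominus>\<^bsub>A\<^esub> a) \<oplus>\<^bsub>A\<^esub> (\<ominus>\<^bsub>A\<^esub> b)" using ab by (simp add: minus_add)
      then show "\<ominus>\<^bsub>A\<^esub> x \<in> J" using J_mem ab component_minus by auto
    next
      fix x y assume "x \<in> J" "y \<in> J"
      then obtain a b a' b' where ab: "a \<in> component A 0" "a \<in> I" "b \<in> component A 1" "b \<in> I"
        "x = a \<oplus>\<^bsub>A\<^esub> b" "a' \<in> component A 0" "a' \<in> I" "b' \<in> component A 1" "b' \<in> I"
        "y = a' \<oplus>\<^bsub>A\<^esub> b'" by (auto simp: J_def)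
      have "x \<oplus>\<^bsub>A\<^esub> y = (a \<oplus>\<^bsub>A\<^esub> a') \<oplus>\<^bsub>A\<^esub> (b \<oplus>\<^bsub>A\<^esub> b')"
        using ab by (simp add: a_ac)
      then show "x \<oplus>\<^bsub>A\<^esub> y \<in> J" using J_mem ab component_add by auto
    qed
    fix x r assume "x \<in> J" and r: "r \<in> carrier A"
    then obtain a b where ab: "a \<in> component A 0" "a \<in> I" "b \<in> component A 1" "b \<in> I"
      "x = a \<oplus>\<^bsub>A\<^esub> b" by (auto simp: J_def)
    obtain c d where cd: "c \<in> component A 0" "d \<in> component A 1" "r = c \<oplus>\<^bsub>A\<^esub> d"
      using homogeneous_decomposition[OF r] .
    have "r \<otimes>\<^bsub>A\<^esub> x = (c \<otimes>\<^bsub>A\<^esub> a \<oplus>\<^bsub>A\<^esub> d \<otimes>\<^bsub>A\<^esub> b) \<oplus>\<^bsub>A\<^esub> (c \<otimes>\<^bsub>A\<^esub> b \<oplus>\<^bsub>A\<^esub> d \<otimes>\<^bsub>A\<^esub> a)"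
      using ab cd by (simp add: l_distr r_distr a_ac)
    moreover have "c \<otimes>\<^bsub>A\<^esub> a \<oplus>\<^bsub>A\<^esub> d \<otimes>\<^bsub>A\<^esub> b \<in> component A 0"
      using component_mult[of c 0 a 0] component_mult[of d 1 b 1] ab cd component_add by simp
    moreover have "c \<otimes>\<^bsub>A\<^esub> b \<oplus>\<^bsub>A\<^esub> d \<otimes>\<^bsub>A\<^esub> a \<in> component A 1"
      using component_mult[of c 0 b 1] component_mult[of d 1 a 0] ab cd component_add by simp
    ultimately show "r \<otimes>\<^bsub>A\<^esub> x \<in> J" using J_mem ab cd I.I_l_closed by auto
    have "x \<otimes>\<^bsub>A\<^esub> r = (a \<otimes>\<^bsub>A\<^esub> c \<oplus>\<^bsub>A\<^esub> b \<otimes>\<^bsub>A\<^esub> d) \<oplus>\<^bsub>A\<^esub> (a \<otimes>\<^bsub>A\<^esub> d \<oplus>\<^bsub>A\<^esub> b \<otimes>\<^bsub>A\<^esub> c)"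
      using ab cd by (simp add: l_distr r_distr a_ac)
    moreover have "a \<otimes>\<^bsub>A\<^esub> c \<oplus>\<^bsub>A\<^esub> b \<otimes>\<^bsub>A\<^esub> d \<in> component A 0"
      using component_mult[of a 0 c 0] component_mult[of b 1 d 1] ab cd component_add by simp
    moreover have "a \<otimes>\<^bsub>A\<^esub> d \<oplus>\<^bsub>A\<^esub> b \<otimes>\<^bsub>A\<^esub> c \<in> component A 1"
      using component_mult[of a 0 d 1] component_mult[of b 1 c 0] ab cd component_add by simp
    ultimately show "x \<otimes>\<^bsub>A\<^esub> r \<in> J" using J_mem ab cd I.I_r_closed by auto
  qed
  moreover have "S \<subseteq> J"
  proof
    fix s assume s: "s \<in> S"
    then have sI: "s \<in> I" using genideal_self[OF gens_subset] by blast
    have "s \<oplus>\<^bsub>A\<^esub> \<zero>\<^bsub>A\<^esub> \<in> J \<or> \<zero>\<^bsub>A\<^esub> \<oplus>\<^bsub>A\<^esub> s \<in> J"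
      using s sI homogeneous J_mem[of s "\<zero>\<^bsub>A\<^esub>"] J_mem[of "\<zero>\<^bsub>A\<^esub>" s] component_zero by auto
    then show "s \<in> J" using s gens_subset by auto
  qed
  ultimately have "I \<subseteq> J" by (rule genideal_minimal)
  then show ?thesis using assms unfolding J_def by blast
qed

lemma carrier_Q: "carrier Q = (\<lambda>x. I +>\<^bsub>A\<^esub> x) ` carrier A"
  by (auto simp: quotient_superalgebra_def FactRing_simps)

lemma mult_Q: "x \<in> carrier A \<Longrightarrow> y \<in> carrier A \<Longrightarrow>
    (I +>\<^bsub>A\<^esub> x) \<otimes>\<^bsub>Q\<^esub> (I +>\<^bsub>A\<^esub> y) = I +>\<^bsub>A\<^esub> (x \<otimes>\<^bsub>A\<^esub> y)"
  using ideal.rcoset_mult_add[OF ideal_I] by (simp add: quotient_superalgebra_def FactRing_def)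

lemma add_Q: "x \<in> carrier A \<Longrightarrow> y \<in> carrier A \<Longrightarrow>
    (I +>\<^bsub>A\<^esub> x) \<oplus>\<^bsub>Q\<^esub> (I +>\<^bsub>A\<^esub> y) = I +>\<^bsub>A\<^esub> (x \<oplus>\<^bsub>A\<^esub> y)"
  using ideal.a_rcos_sum[OF ideal_I] by (simp add: quotient_superalgebra_def FactRing_def)

lemma coset_eq_iff: "x \<in> carrier A \<Longrightarrow> y \<in> carrier A \<Longrightarrow>
    I +>\<^bsub>A\<^esub> x = I +>\<^bsub>A\<^esub> y \<longleftrightarrow> x \<ominus>\<^bsub>A\<^esub> y \<in> I"
  using quotient_eq_iff_same_a_r_cos[OF ideal_I] by blast

lemma one_Q: "\<one>\<^bsub>Q\<^esub> = I +>\<^bsub>A\<^esub> \<one>\<^bsub>A\<^esub>"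
  by (simp add: quotient_superalgebra_def FactRing_def)

lemma zero_Q: "\<zero>\<^bsub>Q\<^esub> = I +>\<^bsub>A\<^esub> \<zero>\<^bsub>A\<^esub>"
proof -
  interpret I: ideal I A by (rule ideal_I)
  show ?thesis
    using a_coset_add_zero[OF I.a_subset]
    by (simp add: quotient_superalgebra_def FactRing_def)
qed

lemma component_Q: "component Q s = (\<lambda>x. I +>\<^bsub>A\<^esub> x) ` component A s"
  by (simp add: quotient_superalgebra_def)

text \<open>The scalar action on a coset is a union over all of its members; they all give the same coset
  because \<open>c i = (c 1) i\<close> stays in the ideal.\<close>

lemma smult_Q:
  assumes "c \<in> carrier R" "x \<in> carrier A"
  shows "c \<odot>\<^bsub>Q\<^esub> (I +>\<^bsub>A\<^esub> x) = I +>\<^bsub>A\<^esub> (c \<odot>\<^bsub>A\<^esub> x)"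
proof -
  interpret I: ideal I A by (rule ideal_I)
  have "I +>\<^bsub>A\<^esub> (c \<odot>\<^bsub>A\<^esub> y) = I +>\<^bsub>A\<^esub> (c \<odot>\<^bsub>A\<^esub> x)" if y: "y \<in> I +>\<^bsub>A\<^esub> x" for y
  proof -
    obtain i where i: "i \<in> I" "y = i \<oplus>\<^bsub>A\<^esub> x"
      using y by (auto simp: a_r_coset_def')
    then have "c \<odot>\<^bsub>A\<^esub> y = c \<odot>\<^bsub>A\<^esub> i \<oplus>\<^bsub>A\<^esub> c \<odot>\<^bsub>A\<^esub> x"
      using assms I.Icarr by (simp add: smult_r_distr)
    then have "c \<odot>\<^bsub>A\<^esub> y \<in> I +>\<^bsub>A\<^esub> (c \<odot>\<^bsub>A\<^esub> x)"
      using ideal_smult_closed[OF assms(1) i(1)] by (auto simp: a_r_coset_def')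
    then show ?thesis using I.a_repr_independence' assms by simp
  qed
  then have "(\<Union>y\<in>I +>\<^bsub>A\<^esub> x. I +>\<^bsub>A\<^esub> (c \<odot>\<^bsub>A\<^esub> y))
      = (\<Union>y\<in>I +>\<^bsub>A\<^esub> x. I +>\<^bsub>A\<^esub> (c \<odot>\<^bsub>A\<^esub> x))"
    by (rule SUP_cong[OF refl])
  also have "\<dots> = I +>\<^bsub>A\<^esub> (c \<odot>\<^bsub>A\<^esub> x)"
    using I.a_rcos_self[OF assms(2)] by blast
  finally show ?thesis by (simp add: quotient_superalgebra_def)
qed

lemma ring_Q: "ring Q"
proof (rule ringI)
  show "abelian_group Q"
  proof (rule abelian_groupI)
    fix z assume "z \<in> carrier Q"
    then obtain x where x: "x \<in> carrier A" "z = I +>\<^bsub>A\<^esub> x" by (auto simp: carrier_Q)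
    then have "(I +>\<^bsub>A\<^esub> (\<ominus>\<^bsub>A\<^esub> x)) \<oplus>\<^bsub>Q\<^esub> z = \<zero>\<^bsub>Q\<^esub>"
      by (simp add: add_Q zero_Q l_neg)
    then show "\<exists>y\<in>carrier Q. y \<oplus>\<^bsub>Q\<^esub> z = \<zero>\<^bsub>Q\<^esub>" using x by (auto simp: carrier_Q)
  qed (auto simp: carrier_Q add_Q zero_Q a_ac)
  show "Group.monoid Q"
    by (rule monoidI) (auto simp: carrier_Q mult_Q one_Q m_assoc)
qed (auto simp: carrier_Q add_Q mult_Q l_distr r_distr)

lemma module_Q: "module R Q"
proof (rule moduleI)
  show "cring R" by (rule R.cring_axioms)
  show "abelian_group Q" using ring_Q ring.is_abelian_group by blast
qed (auto simp: carrier_Q smult_Q add_Q smult_l_distr smult_r_distr smult_assoc1)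

text \<open>The point is that the two components of the quotient meet only in zero: if an even \<open>x\<close> and an odd
  \<open>y\<close> have the same coset, then \<open>x - y\<close> lies in the ideal, and so does its even part \<open>x\<close>.\<close>

theorem superalgebra_Q: "superalgebra R Q"
proof -
  interpret Q: ring Q by (rule ring_Q)
  interpret QM: module R Q by (rule module_Q)
  interpret I: ideal I A by (rule ideal_I)
  have sub: "component Q s \<subseteq> carrier Q" for s
    using component_subset by (auto simp: component_Q carrier_Q)
  show ?thesis
  proof (intro superalgebra.intro superalgebra_axioms.intro module_Q ring_Q)
    fix c x y assume "c \<in> carrier R" "x \<in> carrier Q" "y \<in> carrier Q"
    then show "(c \<odot>\<^bsub>Q\<^esub> x) \<otimes>\<^bsub>Q\<^esub> y = c \<odot>\<^bsub>Q\<^esub> (x \<otimes>\<^bsub>Q\<^esub> y)"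
      "x \<otimes>\<^bsub>Q\<^esub> (c \<odot>\<^bsub>Q\<^esub> y) = c \<odot>\<^bsub>Q\<^esub> (x \<otimes>\<^bsub>Q\<^esub> y)"
      by (auto simp: carrier_Q smult_Q mult_Q smult_mult_left smult_mult_right)
  next
    fix s show "submodule (component Q s) R Q"
    proof (rule QM.submoduleI)
      show "component Q s \<subseteq> carrier Q" by (rule sub)
      show "\<zero>\<^bsub>Q\<^esub> \<in> component Q s" using component_zero by (auto simp: component_Q zero_Q)
      fix a assume "a \<in> component Q s"
      then obtain x where x: "x \<in> component A s" "a = I +>\<^bsub>A\<^esub> x" by (auto simp: component_Q)
      have "(I +>\<^bsub>A\<^esub> (\<ominus>\<^bsub>A\<^esub> x)) \<oplus>\<^bsub>Q\<^esub> (I +>\<^bsub>A\<^esub> x) = \<zero>\<^bsub>Q\<^esub>"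
        using x by (simp add: add_Q zero_Q l_neg)
      then have "\<ominus>\<^bsub>Q\<^esub> a = I +>\<^bsub>A\<^esub> (\<ominus>\<^bsub>A\<^esub> x)"
        using x by (intro Q.minus_equality) (auto simp: carrier_Q)
      then show "\<ominus>\<^bsub>Q\<^esub> a \<in> component Q s" using x component_minus by (auto simp: component_Q)
    next
      fix a b assume "a \<in> component Q s" "b \<in> component Q s"
      then obtain x y where "x \<in> component A s" "a = I +>\<^bsub>A\<^esub> x" "y \<in> component A s" "b = I +>\<^bsub>A\<^esub> y"
        by (auto simp: component_Q)
      then show "a \<oplus>\<^bsub>Q\<^esub> b \<in> component Q s" using component_add by (auto simp: component_Q add_Q)
    next
      fix c a assume "c \<in> carrier R" "a \<in> component Q s"
      then show "c \<odot>\<^bsub>Q\<^esub> a \<in> component Q s"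
        using component_smult by (auto simp: component_Q smult_Q)
    qed
  next
    show "component Q 0 <+>\<^bsub>Q\<^esub> component Q 1 = carrier Q"
    proof (rule equalityI)
      show "component Q 0 <+>\<^bsub>Q\<^esub> component Q 1 \<subseteq> carrier Q"
        by (rule Q.set_add_closed[OF sub sub])
      show "carrier Q \<subseteq> component Q 0 <+>\<^bsub>Q\<^esub> component Q 1"
      proof
        fix z assume "z \<in> carrier Q"
        then obtain x where x: "x \<in> carrier A" "z = I +>\<^bsub>A\<^esub> x" by (auto simp: carrier_Q)
        obtain a b where "a \<in> component A 0" "b \<in> component A 1" "x = a \<oplus>\<^bsub>A\<^esub> b"
          using homogeneous_decomposition[OF x(1)] .
        then show "z \<in> component Q 0 <+>\<^bsub>Q\<^esub> component Q 1"
          using x(2) add_Q[of a b] unfolding set_add_def' component_Q by fastforce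
      qed
    qed
  next
    show "component Q 0 \<inter> component Q 1 = {\<zero>\<^bsub>Q\<^esub>}"
    proof (intro equalityI subsetI)
      fix z assume "z \<in> component Q 0 \<inter> component Q 1"
      then obtain x y where xy: "x \<in> component A 0" "y \<in> component A 1"
        "z = I +>\<^bsub>A\<^esub> x" "z = I +>\<^bsub>A\<^esub> y" by (auto simp: component_Q)
      then have "x \<ominus>\<^bsub>A\<^esub> y \<in> I" using coset_eq_iff[of x y] by auto
      then obtain a b where ab: "a \<in> component A 0" "a \<in> I" "b \<in> component A 1" "b \<in> I"
        "x \<ominus>\<^bsub>A\<^esub> y = a \<oplus>\<^bsub>A\<^esub> b" using ideal_homogeneous by blast
      \<comment> \<open>Comparing even and odd parts of \<open>x - y = a + b\<close> gives \<open>x = a\<close>.\<close>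
      have "x \<oplus>\<^bsub>A\<^esub> (\<ominus>\<^bsub>A\<^esub> a) = y \<oplus>\<^bsub>A\<^esub> b"
      proof -
        have cs: "x \<in> carrier A" "y \<in> carrier A" "a \<in> carrier A" "b \<in> carrier A"
          using xy ab by auto
        have "x \<oplus>\<^bsub>A\<^esub> (\<ominus>\<^bsub>A\<^esub> a) = (x \<ominus>\<^bsub>A\<^esub> y) \<oplus>\<^bsub>A\<^esub> (y \<oplus>\<^bsub>A\<^esub> (\<ominus>\<^bsub>A\<^esub> a))"
          using cs by (simp add: a_minus_def a_assoc r_neg2 r_neg1)
        also have "\<dots> = (a \<oplus>\<^bsub>A\<^esub> b) \<oplus>\<^bsub>A\<^esub> (y \<oplus>\<^bsub>A\<^esub> (\<ominus>\<^bsub>A\<^esub> a))"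
          by (simp only: ab(5))
        also have "\<dots> = (a \<oplus>\<^bsub>A\<^esub> (\<ominus>\<^bsub>A\<^esub> a)) \<oplus>\<^bsub>A\<^esub> (y \<oplus>\<^bsub>A\<^esub> b)"
          using cs by (simp add: a_ac)
        finally show ?thesis using cs by (simp add: r_neg)
      qed
      moreover have "x \<oplus>\<^bsub>A\<^esub> (\<ominus>\<^bsub>A\<^esub> a) \<in> component A 0"
        using xy ab component_add component_minus by blast
      moreover have "y \<oplus>\<^bsub>A\<^esub> b \<in> component A 1"
        using xy ab component_add by blast
      ultimately have "x \<oplus>\<^bsub>A\<^esub> (\<ominus>\<^bsub>A\<^esub> a) = \<zero>\<^bsub>A\<^esub>" using component_disjoint by auto
      then have "x \<ominus>\<^bsub>A\<^esub> a = \<zero>\<^bsub>A\<^esub>" by (simp add: a_minus_def)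
      then have "x = a" using xy ab by simp
      then have "x \<ominus>\<^bsub>A\<^esub> \<zero>\<^bsub>A\<^esub> \<in> I" using ab by (simp add: a_minus_def)
      then have "z = I +>\<^bsub>A\<^esub> \<zero>\<^bsub>A\<^esub>" using xy coset_eq_iff[of x "\<zero>\<^bsub>A\<^esub>"] by simp
      then show "z \<in> {\<zero>\<^bsub>Q\<^esub>}" by (simp add: zero_Q)
    qed (use component_zero in \<open>auto simp: component_Q zero_Q\<close>)
  next
    fix s t x y assume "x \<in> component Q s" "y \<in> component Q t"
    then obtain a b where "a \<in> component A s" "x = I +>\<^bsub>A\<^esub> a"
      "b \<in> component A t" "y = I +>\<^bsub>A\<^esub> b" unfolding component_Q by blast
    then show "x \<otimes>\<^bsub>Q\<^esub> y \<in> component Q (s + t)"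
      unfolding component_Q using component_mult[of a s b t] mult_Q[of a b] by fastforce
  qed
qed

lemma projection_hom: "superalgebra_hom R A Q (\<lambda>x. I +>\<^bsub>A\<^esub> x)"
proof -
  interpret Q: superalgebra R Q by (rule superalgebra_Q)
  show ?thesis
  proof
    show "(\<lambda>x. I +>\<^bsub>A\<^esub> x) \<in> ring_hom A Q"
      by (rule ring_hom_memI) (auto simp: carrier_Q mult_Q add_Q one_Q)
  qed (auto simp: smult_Q component_Q)
qed

theorem quotient_universal:
  assumes "superalgebra_hom R A B h" and kills: "\<And>s. s \<in> S \<Longrightarrow> h s = \<zero>\<^bsub>B\<^esub>"
  shows "\<exists>\<pi> \<in> extensional (carrier Q). superalgebra_hom R Q B \<pi> \<and>
    (\<forall>x \<in> carrier A. \<pi> (I +>\<^bsub>A\<^esub> x) = h x)"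
proof -
  interpret h: superalgebra_hom R A B h by fact
  interpret Q: superalgebra R Q by (rule superalgebra_Q)
  interpret I: ideal I A by (rule ideal_I)
  interpret hr: ring_hom_ring A B h
    by (rule ring_hom_ringI2[OF ring_axioms h.cod.ring_axioms h.ring_hom])
  have "ideal (a_kernel A B h) A" by (rule hr.kernel_is_ideal)
  moreover have "S \<subseteq> a_kernel A B h"
    unfolding a_kernel_def' using kills gens_subset by blast
  ultimately have ker: "I \<subseteq> a_kernel A B h" by (rule genideal_minimal)
  have hI: "h i = \<zero>\<^bsub>B\<^esub>" if "i \<in> I" for i
    using ker that unfolding a_kernel_def' by blast
  define \<pi> where "\<pi> = restrict (\<lambda>C. the_elem (h ` C)) (carrier Q)"
  have \<pi>: "\<pi> (I +>\<^bsub>A\<^esub> x) = h x" if x: "x \<in> carrier A" for x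
  proof -
    have "h y = h x" if "y \<in> I +>\<^bsub>A\<^esub> x" for y
    proof -
      have "y \<in> (\<Union>i\<in>I. {i \<oplus>\<^bsub>A\<^esub> x})" using that by (simp only: a_r_coset_def')
      then obtain i where i: "i \<in> I" and "y \<in> {i \<oplus>\<^bsub>A\<^esub> x}" by (rule UN_E)
      then have "y = i \<oplus>\<^bsub>A\<^esub> x" by (simp only: singleton_iff)
      then have "h y = h i \<oplus>\<^bsub>B\<^esub> h x" using hr.hom_add[OF I.Icarr[OF i] x] by (simp only:)
      then show ?thesis using x hI[OF i] hr.hom_closed[OF x] by simp
    qed
    then have "h ` (I +>\<^bsub>A\<^esub> x) = {h x}" using I.a_rcos_self[OF x] by blast
    then show ?thesis using x by (simp add: \<pi>_def carrier_Q)
  qed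
  have "superalgebra_hom R Q B \<pi>"
  proof
    show "\<pi> \<in> ring_hom Q B"
      by (rule ring_hom_memI) (auto simp: carrier_Q mult_Q add_Q one_Q \<pi>)
  qed (auto simp: carrier_Q smult_Q component_Q \<pi> h.linear h.preserves_parity)
  moreover have "\<pi> \<in> extensional (carrier Q)" by (simp add: \<pi>_def)
  ultimately show ?thesis using \<pi> by blast
qed

end

section \<open>Free superalgebras\<close>

lemma ground_field_simps [simp]:
  "carrier (ring_of_type_algebra :: 'a::comm_ring_1 ring) = UNIV"
  "x \<oplus>\<^bsub>ring_of_type_algebra\<^esub> y = x + (y :: 'a)"
  "x \<otimes>\<^bsub>ring_of_type_algebra\<^esub> y = x * (y :: 'a)"
  "\<zero>\<^bsub>ring_of_type_algebra\<^esub> = (0 :: 'a)"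
  "\<one>\<^bsub>ring_of_type_algebra\<^esub> = (1 :: 'a)"
  by (simp_all add: ring_of_type_algebra_def)

lemma free_superalgebra_simps [simp]:
  "carrier (free_superalgebra G p) = free_carrier G"
  "x \<otimes>\<^bsub>free_superalgebra G p\<^esub> y = x * y"
  "x \<oplus>\<^bsub>free_superalgebra G p\<^esub> y = x + y"
  "\<one>\<^bsub>free_superalgebra G p\<^esub> = 1"
  "\<zero>\<^bsub>free_superalgebra G p\<^esub> = 0"
  "c \<odot>\<^bsub>free_superalgebra G p\<^esub> x = scal c * x"
  by (simp_all add: free_superalgebra_def)

lemma component_free:
  "component (free_superalgebra G p) s =
    {a \<in> free_carrier G. \<forall>w \<in> Poly_Mapping.keys a. word_parity p w = s}"
  by (simp add: free_superalgebra_def)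

lemma letters_zero [simp]: "letters 0 = []"
  by (simp add: zero_fword_def)

lemma letters_plus [simp]: "letters (u + w) = letters u @ letters w"
  by (simp add: plus_fword_def)

lemma word_parity_zero [simp]: "word_parity p 0 = 0"
  by (simp add: word_parity_def)

lemma word_parity_plus [simp]: "word_parity p (u + w) = word_parity p u + word_parity p w"
  by (simp add: word_parity_def)

lemma scal_simps:
  "scal 0 = 0" "scal 1 = 1" "scal (c + d) = scal c + scal d" "scal (c * d) = scal c * scal d"
  "scal (- c) = - scal c"
  by (simp_all add: scal_def single_add mult_single single_uminus)

lemma scal_mult_single: "scal c * Poly_Mapping.single w d = Poly_Mapping.single w (c * d)"
  by (simp add: scal_def mult_single)

text \<open>Only monomials in the support of the given element have to be considered. Membership in a free
  superalgebra or in one of its components is a condition on the support, so it is available for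
  each of these monomials.\<close>

lemma poly_mapping_add_induct [case_names zero single add]:
  fixes a :: "'k \<Rightarrow>\<^sub>0 'v::monoid_add"
  assumes "P 0" "\<And>w c. w \<in> Poly_Mapping.keys a \<Longrightarrow> P (Poly_Mapping.single w c)" "\<And>x y. P x \<Longrightarrow> P y \<Longrightarrow> P (x + y)"
  shows "P a"
proof -
  have "Poly_Mapping.keys b \<subseteq> Poly_Mapping.keys a \<Longrightarrow> P b" for b
  proof (induction b rule: update_induct)
    case const
    then show ?case using assms(1) by (simp add: zero_poly_mapping.abs_eq[symmetric])
  next
    case (update f k v)
    have eq: "Poly_Mapping.update k v f = f + Poly_Mapping.single k v"
      using update(1) by (intro poly_mapping_eqI)
        (auto simp: lookup_update lookup_add lookup_single when_def in_keys_iff)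
    show ?case using update assms by (simp add: eq[symmetric] keys_update) (simp add: eq assms)
  qed
  then show ?thesis by simp
qed

lemma scal_central: "scal c * a = a * scal c"
  by (induction a rule: poly_mapping_add_induct)
    (simp_all add: scal_def mult_single distrib_left distrib_right mult.commute)

lemma free_carrier_closed [simp, intro]:
  "0 \<in> free_carrier G" "1 \<in> free_carrier G" "scal c \<in> free_carrier G"
  "g \<in> G \<Longrightarrow> gen g \<in> free_carrier G"
  "a \<in> free_carrier G \<Longrightarrow> b \<in> free_carrier G \<Longrightarrow> a + b \<in> free_carrier G"
  "a \<in> free_carrier G \<Longrightarrow> b \<in> free_carrier G \<Longrightarrow> a * b \<in> free_carrier G"
  "a \<in> free_carrier G \<Longrightarrow> - a \<in> free_carrier G"
proof -
  show "a \<in> free_carrier G \<Longrightarrow> b \<in> free_carrier G \<Longrightarrow> a + b \<in> free_carrier G"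
    using keys_add[of a b] by (auto simp: free_carrier_def)
  show "a \<in> free_carrier G \<Longrightarrow> b \<in> free_carrier G \<Longrightarrow> a * b \<in> free_carrier G"
    using keys_mult[of a b] by (fastforce simp: free_carrier_def)
qed (auto simp: free_carrier_def gen_def scal_def in_keys_iff split: if_splits)

lemma free_carrier_diff [simp, intro]:
  "a \<in> free_carrier G \<Longrightarrow> b \<in> free_carrier G \<Longrightarrow> a - b \<in> free_carrier G"
  using free_carrier_closed(5)[of a G "- b"] by simp

lemma component_free_closed:
  "0 \<in> component (free_superalgebra G p) s"
  "1 \<in> component (free_superalgebra G p) 0"
  "scal c \<in> component (free_superalgebra G p) 0"
  "g \<in> G \<Longrightarrow> gen g \<in> component (free_superalgebra G p) (p g)"
  "a \<in> component (free_superalgebra G p) s \<Longrightarrow> b \<in> component (free_superalgebra G p) s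
    \<Longrightarrow> a + b \<in> component (free_superalgebra G p) s"
  "a \<in> component (free_superalgebra G p) s \<Longrightarrow> - a \<in> component (free_superalgebra G p) s"
  "a \<in> component (free_superalgebra G p) s \<Longrightarrow> b \<in> component (free_superalgebra G p) t
    \<Longrightarrow> a * b \<in> component (free_superalgebra G p) (s + t)"
proof -
  show "a \<in> component (free_superalgebra G p) s \<Longrightarrow> b \<in> component (free_superalgebra G p) s
    \<Longrightarrow> a + b \<in> component (free_superalgebra G p) s"
    using keys_add[of a b] by (auto simp: component_free)
  show "a * b \<in> component (free_superalgebra G p) (s + t)"
    if a: "a \<in> component (free_superalgebra G p) s" and b: "b \<in> component (free_superalgebra G p) t"
  proof -
    have "word_parity p w = s + t" if w: "w \<in> Poly_Mapping.keys (a * b)" for w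
    proof -
      obtain u v where "w = u + v" "u \<in> Poly_Mapping.keys a" "v \<in> Poly_Mapping.keys b"
        using w keys_mult[of a b] by blast
      then show ?thesis using a b by (auto simp only: component_free mem_Collect_eq word_parity_plus)
    qed
    then show ?thesis using a b unfolding component_free by blast
  qed
qed (auto simp: component_free gen_def scal_def word_parity_def in_keys_iff lookup_single when_def
    free_carrier_def lookup_one zero_fword_def split: if_splits)

theorem superalgebra_free: "superalgebra ground_field (free_superalgebra G p)"
proof -
  have add: "abelian_group (free_superalgebra G p)"
    by (rule abelian_groupI) (auto simp: add_ac intro!: bexI[of _ "- x" for x])
  have ring: "ring (free_superalgebra G p)"
    by (rule ringI[OF add monoidI]) (auto simp: mult.assoc distrib_left distrib_right)
  have module: "module ground_field (free_superalgebra G p)"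
    by (rule moduleI[OF cring_from_type_algebra add])
      (auto simp: scal_simps mult.assoc distrib_left distrib_right)
  interpret ring "free_superalgebra G p" by (rule ring)
  interpret M: module ground_field "free_superalgebra G p" by (rule module)
  have neg: "\<ominus>\<^bsub>free_superalgebra G p\<^esub> a = - a" if "a \<in> free_carrier G" for a
    using that by (intro minus_equality) auto
  show ?thesis
  proof (intro superalgebra.intro superalgebra_axioms.intro module ring)
    fix s show "submodule (component (free_superalgebra G p) s) ground_field (free_superalgebra G p)"
    proof (rule M.submoduleI)
      fix a c assume "a \<in> component (free_superalgebra G p) s"
      then show "c \<odot>\<^bsub>free_superalgebra G p\<^esub> a \<in> component (free_superalgebra G p) s"
        using component_free_closed(7)[OF component_free_closed(3)[of c], of a G p s]
        by (simp only: free_superalgebra_simps add_0)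
    next
      fix a assume "a \<in> component (free_superalgebra G p) s"
      then show "\<ominus>\<^bsub>free_superalgebra G p\<^esub> a \<in> component (free_superalgebra G p) s"
        using component_free_closed(6)[of a] neg[of a] by (auto simp: component_free)
    next
      show "component (free_superalgebra G p) s \<subseteq> carrier (free_superalgebra G p)"
        by (auto simp: component_free)
    qed (simp_all add: component_free_closed(1,5))
  next
    have "a \<in> component (free_superalgebra G p) 0 <+>\<^bsub>free_superalgebra G p\<^esub> component (free_superalgebra G p) 1"
      if a: "a \<in> free_carrier G" for a
    proof -
      define hpart where "hpart s = Poly_Mapping.mapp (\<lambda>w c. if word_parity p w = s then c else 0) a" for s
      have lookup_hpart: "Poly_Mapping.lookup (hpart s) w
          = (if word_parity p w = s then Poly_Mapping.lookup a w else 0)" for s w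
        unfolding hpart_def by (simp add: lookup_mapp when_def in_keys_iff)
      have "hpart s \<in> component (free_superalgebra G p) s" for s
        using a by (auto simp: component_free free_carrier_def in_keys_iff lookup_hpart
            split: if_splits)
      moreover have "a = hpart 0 + hpart 1"
        by (intro poly_mapping_eqI) (auto simp: lookup_add lookup_hpart)
      ultimately show ?thesis unfolding set_add_def' by auto
    qed
    then show "component (free_superalgebra G p) 0 <+>\<^bsub>free_superalgebra G p\<^esub> component (free_superalgebra G p) 1
        = carrier (free_superalgebra G p)"
      unfolding set_add_def' by (auto simp: component_free)
    have "a = 0" if "a \<in> component (free_superalgebra G p) 0" "a \<in> component (free_superalgebra G p) 1" for a
    proof (rule poly_mapping_eqI)
      fix w show "Poly_Mapping.lookup a w = Poly_Mapping.lookup 0 w"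
        using that by (auto simp: component_free in_keys_iff)
    qed
    then show "component (free_superalgebra G p) 0 \<inter> component (free_superalgebra G p) 1
        = {\<zero>\<^bsub>free_superalgebra G p\<^esub>}"
      using component_free_closed(1) by auto
  next
    fix s t x y
    assume "x \<in> component (free_superalgebra G p) s" "y \<in> component (free_superalgebra G p) t"
    then show "x \<otimes>\<^bsub>free_superalgebra G p\<^esub> y \<in> component (free_superalgebra G p) (s + t)"
      using component_free_closed(7) by (simp only: free_superalgebra_simps)
  next
    fix c x y assume "x \<in> carrier (free_superalgebra G p)" "y \<in> carrier (free_superalgebra G p)"
    show "x \<otimes>\<^bsub>free_superalgebra G p\<^esub> (c \<odot>\<^bsub>free_superalgebra G p\<^esub> y)
        = c \<odot>\<^bsub>free_superalgebra G p\<^esub> (x \<otimes>\<^bsub>free_superalgebra G p\<^esub> y)"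
      using scal_central[of c x] by (simp add: mult.assoc[symmetric])
  qed (simp add: mult.assoc)
qed

context superalgebra
begin

text \<open>Write \<open>1 = a + b\<close> with \<open>a\<close> even and \<open>b\<close> odd. Multiplying \<open>a\<close> and \<open>b\<close> by 1 on the right and
  comparing parities gives \<open>a b = 0\<close> and \<open>b b = 0\<close>, hence \<open>b = 1 b = 0\<close>.\<close>

lemma one_even: "\<one>\<^bsub>A\<^esub> \<in> component A 0"
proof -
  have eq_zero: "z = \<zero>\<^bsub>A\<^esub>" if x: "x \<in> component A s" "y \<in> component A s"
    and z: "z \<in> component A t" "s \<noteq> t" and eq: "y = x \<oplus>\<^bsub>A\<^esub> z" for x y z s t
  proof -
    have c: "x \<in> carrier A" "y \<in> carrier A" "z \<in> carrier A" using x z by simp_all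
    then have "z = \<ominus>\<^bsub>A\<^esub> x \<oplus>\<^bsub>A\<^esub> y" using eq by (simp add: r_neg1)
    then have "z \<in> component A s" using x component_add component_minus by simp
    moreover have "(s = 0 \<and> t = 1) \<or> (s = 1 \<and> t = 0)" using \<open>s \<noteq> t\<close> by (cases s; cases t) auto
    ultimately show ?thesis using z component_disjoint by auto
  qed
  obtain a b where ab: "a \<in> component A 0" "b \<in> component A 1" "\<one>\<^bsub>A\<^esub> = a \<oplus>\<^bsub>A\<^esub> b"
    using homogeneous_decomposition[OF one_closed] .
  have c: "a \<in> carrier A" "b \<in> carrier A" using ab by simp_all
  have "a = a \<otimes>\<^bsub>A\<^esub> \<one>\<^bsub>A\<^esub>" "b = b \<otimes>\<^bsub>A\<^esub> \<one>\<^bsub>A\<^esub>" using c by simp_all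
  then have "a = a \<otimes>\<^bsub>A\<^esub> a \<oplus>\<^bsub>A\<^esub> a \<otimes>\<^bsub>A\<^esub> b" "b = b \<otimes>\<^bsub>A\<^esub> a \<oplus>\<^bsub>A\<^esub> b \<otimes>\<^bsub>A\<^esub> b"
    unfolding ab(3) using c by (simp_all only: r_distr)
  moreover have "a \<otimes>\<^bsub>A\<^esub> a \<in> component A 0" "a \<otimes>\<^bsub>A\<^esub> b \<in> component A 1"
    "b \<otimes>\<^bsub>A\<^esub> a \<in> component A 1" "b \<otimes>\<^bsub>A\<^esub> b \<in> component A 0"
    using component_mult[of a 0 a 0] component_mult[of a 0 b 1] component_mult[of b 1 a 0]
      component_mult[of b 1 b 1] ab by simp_all
  ultimately have "a \<otimes>\<^bsub>A\<^esub> b = \<zero>\<^bsub>A\<^esub>" "b \<otimes>\<^bsub>A\<^esub> b = \<zero>\<^bsub>A\<^esub>"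
    using eq_zero[of "a \<otimes>\<^bsub>A\<^esub> a" 0 a "a \<otimes>\<^bsub>A\<^esub> b" 1]
      eq_zero[of "b \<otimes>\<^bsub>A\<^esub> a" 1 b "b \<otimes>\<^bsub>A\<^esub> b" 0] ab by simp_all
  moreover have "b = a \<otimes>\<^bsub>A\<^esub> b \<oplus>\<^bsub>A\<^esub> b \<otimes>\<^bsub>A\<^esub> b"
    using l_distr[OF c(1,2,2)] c ab(3)[symmetric] by simp
  ultimately have "b = \<zero>\<^bsub>A\<^esub>" by simp
  then show ?thesis using ab c by simp
qed

end

definition word_value :: "('a, 'b, 'm) superalgebra_scheme \<Rightarrow> ('g \<Rightarrow> 'b) \<Rightarrow> 'g fword \<Rightarrow> 'b" where
  "word_value B \<phi> w = foldr (\<lambda>g x. \<phi> g \<otimes>\<^bsub>B\<^esub> x) (letters w) \<one>\<^bsub>B\<^esub>"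

definition free_lift :: "(ratfun, 'b, 'm) superalgebra_scheme \<Rightarrow> ('g \<Rightarrow> 'b) \<Rightarrow> 'g free_alg \<Rightarrow> 'b" where
  "free_lift B \<phi> a =
    (\<Oplus>\<^bsub>B\<^esub>w \<in> Poly_Mapping.keys a. Poly_Mapping.lookup a w \<odot>\<^bsub>B\<^esub> word_value B \<phi> w)"

text \<open>The assignment is total: a generator outside the set of interest can be sent to zero, which lies
  in both components. The induced map is then defined and multiplicative on the full type of
  noncommutative polynomials, whatever the carrier.\<close>

locale graded_assignment = superalgebra ground_field B
  for B :: "(ratfun, 'b, 'm) superalgebra_scheme" (structure) +
  fixes p :: "'g \<Rightarrow> bit" and \<phi> :: "'g \<Rightarrow> 'b"
  assumes assignment: "\<phi> g \<in> component B (p g)"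
begin

lemma assignment_closed [simp]: "\<phi> g \<in> carrier B"
  using assignment component_closed by blast

lemma word_value_parity: "word_value B \<phi> w \<in> component B (word_parity p w)"
proof (cases w)
  case (FWord gs)
  have "foldr (\<lambda>g x. \<phi> g \<otimes>\<^bsub>B\<^esub> x) gs \<one>\<^bsub>B\<^esub> \<in> component B (sum_list (map p gs))"
    by (induction gs) (simp_all only: foldr.simps id_apply o_apply list.map sum_list.Nil
        sum_list.Cons one_even component_mult[OF assignment])
  then show ?thesis by (simp add: word_value_def word_parity_def FWord)
qed

lemma word_value_closed [simp]: "word_value B \<phi> w \<in> carrier B"
  using word_value_parity component_closed by blast

lemma word_value_plus: "word_value B \<phi> (u + w) = word_value B \<phi> u \<otimes>\<^bsub>B\<^esub> word_value B \<phi> w"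
proof -
  have closed: "foldr (\<lambda>g x. \<phi> g \<otimes>\<^bsub>B\<^esub> x) gs \<one>\<^bsub>B\<^esub> \<in> carrier B" for gs
    using word_value_closed[of "FWord gs"] by (simp add: word_value_def)
  have "foldr (\<lambda>g x. \<phi> g \<otimes>\<^bsub>B\<^esub> x) gs (foldr (\<lambda>g x. \<phi> g \<otimes>\<^bsub>B\<^esub> x) hs \<one>\<^bsub>B\<^esub>)
    = foldr (\<lambda>g x. \<phi> g \<otimes>\<^bsub>B\<^esub> x) gs \<one>\<^bsub>B\<^esub> \<otimes>\<^bsub>B\<^esub> foldr (\<lambda>g x. \<phi> g \<otimes>\<^bsub>B\<^esub> x) hs \<one>\<^bsub>B\<^esub>" for gs hs
    by (induction gs) (simp_all add: closed m_assoc)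
  then show ?thesis by (simp add: word_value_def)
qed

lemma free_lift_support:
  assumes "finite K" "Poly_Mapping.keys a \<subseteq> K"
  shows "free_lift B \<phi> a = (\<Oplus>\<^bsub>B\<^esub>w \<in> K. Poly_Mapping.lookup a w \<odot>\<^bsub>B\<^esub> word_value B \<phi> w)"
  unfolding free_lift_def
  using assms smult_l_null by (intro add.finprod_mono_neutral_cong_left) (auto simp: in_keys_iff)

lemma free_lift_closed [simp]: "free_lift B \<phi> a \<in> carrier B"
  unfolding free_lift_def by (rule finsum_closed) auto

lemma free_lift_single: "free_lift B \<phi> (Poly_Mapping.single w c) = c \<odot>\<^bsub>B\<^esub> word_value B \<phi> w"
  using free_lift_support[of "{w}" "Poly_Mapping.single w c"] by (simp add: finsum_insert)

lemma free_lift_zero: "free_lift B \<phi> 0 = \<zero>\<^bsub>B\<^esub>"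
  by (simp add: free_lift_def)

lemma free_lift_add: "free_lift B \<phi> (a + b) = free_lift B \<phi> a \<oplus>\<^bsub>B\<^esub> free_lift B \<phi> b"
proof -
  let ?K = "Poly_Mapping.keys a \<union> Poly_Mapping.keys b"
  have "free_lift B \<phi> (a + b) = (\<Oplus>\<^bsub>B\<^esub>w \<in> ?K. Poly_Mapping.lookup a w \<odot>\<^bsub>B\<^esub> word_value B \<phi> w
      \<oplus>\<^bsub>B\<^esub> Poly_Mapping.lookup b w \<odot>\<^bsub>B\<^esub> word_value B \<phi> w)"
    using free_lift_support[of ?K "a + b"] keys_add[of a b] smult_l_distr
    by (simp add: lookup_add)
  also have "\<dots> = free_lift B \<phi> a \<oplus>\<^bsub>B\<^esub> free_lift B \<phi> b"
    using free_lift_support[of ?K a] free_lift_support[of ?K b] by (simp add: finsum_addf)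
  finally show ?thesis .
qed

lemma free_lift_mult: "free_lift B \<phi> (a * b) = free_lift B \<phi> a \<otimes>\<^bsub>B\<^esub> free_lift B \<phi> b"
proof (induction a rule: poly_mapping_add_induct)
  case (single w c)
  show ?case
  proof (induction b rule: poly_mapping_add_induct)
    case (single v d)
    show ?case
      using smult_assoc1[of c d, symmetric] smult_assoc1[of d c, symmetric]
        smult_mult_left[of c] smult_mult_right[of d]
      by (simp add: mult_single free_lift_single word_value_plus mult.commute)
  qed (simp_all add: free_lift_zero free_lift_add distrib_left r_distr)
qed (simp_all add: free_lift_zero free_lift_add distrib_right l_distr)

lemma free_lift_scal: "free_lift B \<phi> (scal c) = c \<odot>\<^bsub>B\<^esub> \<one>\<^bsub>B\<^esub>"
  by (simp add: scal_def free_lift_single word_value_def)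

lemma free_lift_gen: "free_lift B \<phi> (gen g) = \<phi> g"
  using smult_one by (simp add: gen_def free_lift_single word_value_def)

lemma free_lift_hom: "superalgebra_hom ground_field (free_superalgebra G p) B (free_lift B \<phi>)"
proof (intro superalgebra_hom.intro superalgebra_hom_axioms.intro superalgebra_free superalgebra_axioms)
  show "free_lift B \<phi> \<in> ring_hom (free_superalgebra G p) B"
    using free_lift_scal[of 1] smult_one[OF one_closed]
    by (intro ring_hom_memI) (simp_all add: free_lift_mult free_lift_add scal_simps)
  show "free_lift B \<phi> (c \<odot>\<^bsub>free_superalgebra G p\<^esub> x) = c \<odot>\<^bsub>B\<^esub> free_lift B \<phi> x" for c x
    using smult_mult_left[of c "\<one>\<^bsub>B\<^esub>"] by (simp add: free_lift_mult free_lift_scal)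
  fix a s assume a: "a \<in> component (free_superalgebra G p) s"
  have val: "word_value B \<phi> w \<in> component B s" if "w \<in> Poly_Mapping.keys a" for w
    using a that word_value_parity[of w] by (auto simp: component_free)
  show "free_lift B \<phi> a \<in> component B s"
    by (induction a rule: poly_mapping_add_induct)
     (simp_all add: free_lift_zero component_zero free_lift_single component_smult val
        free_lift_add component_add)
qed

end

text \<open>A free superalgebra is spanned by the words in its generators.\<close>

lemma superalgebra_hom_free_eqI:
  fixes G :: "'g set"
  assumes h: "superalgebra_hom ground_field (free_superalgebra G p) B h"
    and k: "superalgebra_hom ground_field (free_superalgebra G p) B k"
    and eq: "\<And>g. g \<in> G \<Longrightarrow> h (gen g) = k (gen g)"
    and a: "a \<in> free_carrier G"
  shows "h a = k a"
proof -
  interpret h: superalgebra_hom ground_field "free_superalgebra G p" B h by (rule h)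
  interpret k: superalgebra_hom ground_field "free_superalgebra G p" B k by (rule k)
  note hom = ring_hom_mult[OF h.ring_hom, simplified] ring_hom_mult[OF k.ring_hom, simplified]
    ring_hom_add[OF h.ring_hom, simplified] ring_hom_add[OF k.ring_hom, simplified]
    ring_hom_one[OF h.ring_hom, simplified] ring_hom_one[OF k.ring_hom, simplified]
  have lin: "h (scal c * x) = c \<odot>\<^bsub>B\<^esub> h x" "k (scal c * x) = c \<odot>\<^bsub>B\<^esub> k x"
    if "x \<in> free_carrier G" for c x
    using that h.linear[of c x] k.linear[of c x]
    by (simp_all only: free_superalgebra_simps ground_field_simps UNIV_I)
  have word: "h (Poly_Mapping.single (FWord gs) 1) = k (Poly_Mapping.single (FWord gs) 1)
      \<and> Poly_Mapping.single (FWord gs) 1 \<in> free_carrier G"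
    if "set gs \<subseteq> G" for gs
    using that
  proof (induction gs)
    case Nil
    have "Poly_Mapping.single (FWord []) 1 = (1 :: 'g free_alg)"
      by (simp add: zero_fword_def[symmetric])
    then show ?case using hom by simp
  next
    case (Cons g gs)
    have "Poly_Mapping.single (FWord (g # gs)) 1 = gen g * Poly_Mapping.single (FWord gs) (1 :: ratfun)"
      by (simp add: gen_def mult_single plus_fword_def)
    then show ?case using Cons hom eq by simp
  qed
  have "a \<in> free_carrier G \<and> h a = k a"
  proof (induction a rule: poly_mapping_add_induct)
    case zero
    have "scal 0 * (1 :: 'g free_alg) = 0" by (simp add: scal_simps)
    then show ?case using lin[of 1 0] hom(5,6) by simp
  next
    case (single w c)
    then have w: "set (letters w) \<subseteq> G" using a by (auto simp: free_carrier_def)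
    have "Poly_Mapping.single w c = scal c * Poly_Mapping.single (FWord (letters w)) 1"
      by (simp add: scal_mult_single)
    then show ?case using word[OF w] lin by simp
  qed (simp add: hom)
  then show ?thesis ..
qed

section \<open>Scalars\<close>

text \<open>The coefficients that occur have the denominators \<open>q - q\<^sup>-\<^sup>1\<close> and \<open>q\<^sup>1\<^sup>/\<^sup>2 - q\<^sup>-\<^sup>1\<^sup>/\<^sup>2\<close>. Both are
  nonzero because the indeterminate is not a fourth root of unity.\<close>

lemma qh_power4_neq_1: "qh ^ 4 \<noteq> 1"
proof
  assume "qh ^ 4 = 1"
  then have "Fract ([:0, 1:] * [:0, 1:] * [:0, 1:] * [:0, 1:]) 1 = (Fract 1 1 :: ratfun)"
    by (simp add: qh_def numeral_eq_Suc One_fract_def mult.assoc)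
  then show False by (simp add: eq_fract one_pCons)
qed

lemma qh_neq_0 [simp]: "qh \<noteq> 0"
  by (simp add: qh_def Zero_fract_def eq_fract)

lemma qq_neq_0 [simp]: "qq \<noteq> 0"
  by (simp add: qq_def)

lemma qq_square_neq_1: "qq * qq \<noteq> 1"
  using qh_power4_neq_1 by (simp add: qq_def numeral_eq_Suc mult.assoc)

lemma qq_neq_1: "qq \<noteq> 1"
  using qq_square_neq_1 by auto

lemma qq_minus_inverse_neq_0: "qq - inverse qq \<noteq> 0"
  using qq_square_neq_1 by (auto simp: field_simps)

lemma imag_unit_square: "imag_unit * imag_unit = - 1"
  by (simp add: imag_unit_def One_fract_def one_pCons)

lemma imag_unit_neq_0 [simp]: "imag_unit \<noteq> 0"
  using imag_unit_square by auto

lemma inverse_imag_unit: "inverse imag_unit = - imag_unit"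
  using imag_unit_square by (intro inverse_unique) simp

lemma two_neq_0 [simp]: "(2 :: ratfun) \<noteq> 0"
proof -
  have "(of_nat 2 :: ratfun) = Fract (of_nat 2) 1" by (rule of_nat_fract)
  then have "(2 :: ratfun) = Fract 2 1" by simp
  moreover have "Fract 2 1 \<noteq> (Fract 0 1 :: ratfun)" by (simp add: eq_fract)
  ultimately show ?thesis unfolding Zero_fract_def by metis
qed

section \<open>Commutation up to a scalar\<close>

locale ratfun_superalgebra = superalgebra ground_field B
  for B :: "(ratfun, 'b, 'm) superalgebra_scheme" (structure)
begin

text \<open>The module laws over the ground field, freed of the trivial condition that a scalar lies in its
  carrier, so that they serve as rewrite rules.\<close>

lemma smult_smult: "x \<in> carrier B \<Longrightarrow> a \<odot> (b \<odot> x) = (a * b) \<odot> x"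
  using smult_assoc1[of a b x] by simp

lemma smult_add: "x \<in> carrier B \<Longrightarrow> (a + b) \<odot> x = a \<odot> x \<oplus> b \<odot> x"
  using smult_l_distr[of a b x] by simp

lemma smult_closed' [simp]: "x \<in> carrier B \<Longrightarrow> a \<odot> x \<in> carrier B"
  using smult_closed[of a x] by simp

lemma smult_one' [simp]: "x \<in> carrier B \<Longrightarrow> 1 \<odot> x = x"
  using smult_one[of x] by simp

lemma smult_zero' [simp]: "x \<in> carrier B \<Longrightarrow> 0 \<odot> x = \<zero>"
  using smult_l_null[of x] by simp

lemma smult_zero_right [simp]: "a \<odot> \<zero> = \<zero>"
  using smult_r_null[of a] by simp

lemma smult_distr: "x \<in> carrier B \<Longrightarrow> y \<in> carrier B \<Longrightarrow> a \<odot> (x \<oplus> y) = a \<odot> x \<oplus> a \<odot> y"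
  using smult_r_distr[of a x y] by simp

lemma smult_mult:
  "x \<in> carrier B \<Longrightarrow> y \<in> carrier B \<Longrightarrow> (a \<odot> x) \<otimes> y = a \<odot> (x \<otimes> y)"
  "x \<in> carrier B \<Longrightarrow> y \<in> carrier B \<Longrightarrow> x \<otimes> (a \<odot> y) = a \<odot> (x \<otimes> y)"
  using smult_mult_left[of a x y] smult_mult_right[of a x y] by simp_all

lemma minus_eq_smult: "x \<in> carrier B \<Longrightarrow> \<ominus> x = (- 1) \<odot> x"
  using smult_add[of x 1 "-1"] by (intro minus_equality) (simp_all add: a_comm)

lemma diff_eq_smult: "x \<in> carrier B \<Longrightarrow> y \<in> carrier B \<Longrightarrow> x \<ominus> y = x \<oplus> (- 1) \<odot> y"
  by (simp add: a_minus_def minus_eq_smult)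

lemmas linear_simps = smult_smult smult_distr smult_mult diff_eq_smult

lemma smult_eq_zeroD:
  assumes "a \<odot> x = \<zero>" "a \<noteq> 0" "x \<in> carrier B"
  shows "x = \<zero>"
proof -
  have "inverse a \<odot> (a \<odot> x) = \<zero>" using assms by simp
  then show ?thesis unfolding smult_smult[OF assms(3)] using assms(2,3) by simp
qed

definition qcomm :: "ratfun \<Rightarrow> 'b \<Rightarrow> 'b \<Rightarrow> bool" where
  "qcomm s x y \<longleftrightarrow> x \<otimes> y = s \<odot> (y \<otimes> x)"

lemma qcomm_mult_right:
  assumes "qcomm s x y" "qcomm t x z" "x \<in> carrier B" "y \<in> carrier B" "z \<in> carrier B"
  shows "qcomm (s * t) x (y \<otimes> z)"
proof -
  have "x \<otimes> (y \<otimes> z) = (x \<otimes> y) \<otimes> z" using assms by (simp add: m_assoc)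
  also have "\<dots> = s \<odot> (y \<otimes> (x \<otimes> z))" using assms by (simp add: qcomm_def smult_mult m_assoc)
  also have "\<dots> = (s * t) \<odot> ((y \<otimes> z) \<otimes> x)"
    using assms by (simp add: qcomm_def smult_mult m_assoc smult_smult)
  finally show ?thesis by (simp add: qcomm_def)
qed

lemma qcomm_mult_left:
  assumes "qcomm s x z" "qcomm t y z" "x \<in> carrier B" "y \<in> carrier B" "z \<in> carrier B"
  shows "qcomm (s * t) (x \<otimes> y) z"
proof -
  have "(x \<otimes> y) \<otimes> z = x \<otimes> (y \<otimes> z)" using assms by (simp add: m_assoc)
  also have "\<dots> = t \<odot> ((x \<otimes> z) \<otimes> y)" using assms(2-) by (simp add: qcomm_def smult_mult m_assoc)
  also have "x \<otimes> z = s \<odot> (z \<otimes> x)" using assms by (simp add: qcomm_def)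
  also have "t \<odot> (s \<odot> (z \<otimes> x) \<otimes> y) = (s * t) \<odot> (z \<otimes> (x \<otimes> y))"
    using assms(3-5) by (simp add: smult_mult m_assoc smult_smult mult.commute)
  finally show ?thesis by (simp add: qcomm_def)
qed

lemma qcomm_smult_right:
  "qcomm s x y \<Longrightarrow> x \<in> carrier B \<Longrightarrow> y \<in> carrier B \<Longrightarrow> qcomm s x (c \<odot> y)"
  by (simp add: qcomm_def smult_mult smult_smult mult.commute)

lemma qcomm_smult_left:
  "qcomm s x y \<Longrightarrow> x \<in> carrier B \<Longrightarrow> y \<in> carrier B \<Longrightarrow> qcomm s (c \<odot> x) y"
  by (simp add: qcomm_def smult_mult smult_smult mult.commute)

lemma qcomm_one: "qcomm 1 x y \<Longrightarrow> x \<in> carrier B \<Longrightarrow> y \<in> carrier B \<Longrightarrow> x \<otimes> y = y \<otimes> x"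
  by (simp add: qcomm_def)

lemma qcomm_of_inverse:
  assumes "qcomm s x y" "s \<noteq> 0" "x \<otimes> x' = \<one>" "x' \<otimes> x = \<one>"
    and "x \<in> carrier B" "x' \<in> carrier B" "y \<in> carrier B"
  shows "qcomm (inverse s) x' y"
proof -
  have "y \<otimes> x' = x' \<otimes> (x \<otimes> y) \<otimes> x'" using assms by (simp add: m_assoc[symmetric])
  also have "\<dots> = s \<odot> (x' \<otimes> y \<otimes> (x \<otimes> x'))"
    using assms(1,5-7) by (simp add: qcomm_def smult_mult m_assoc)
  also have "\<dots> = s \<odot> (x' \<otimes> y)" using assms by simp
  finally show ?thesis using assms by (simp add: qcomm_def smult_smult)
qed

text \<open>A square-zero element kills any word in which it occurs twice and can be moved past what lies
  between the two occurrences.\<close>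

lemma qcomm_sandwich:
  assumes "qcomm s u w" "u \<otimes> u = \<zero>" "u \<in> carrier B" "w \<in> carrier B"
  shows "u \<otimes> (w \<otimes> u) = \<zero>"
proof -
  have "u \<otimes> (w \<otimes> u) = s \<odot> (w \<otimes> (u \<otimes> u))"
    using assms(1,3,4) by (simp add: m_assoc[symmetric]) (simp add: qcomm_def smult_mult m_assoc)
  then show ?thesis using assms by simp
qed

section \<open>The adjoint action\<close>

text \<open>The operator \<open>Ad\<close> of the quantum supergroup, in an arbitrary superalgebra; the scalar \<open>c\<close> takes the
  place of the sign, which depends on the parity of the argument.\<close>

definition adj :: "ratfun \<Rightarrow> 'b \<Rightarrow> 'b \<Rightarrow> 'b \<Rightarrow> 'b \<Rightarrow> 'b" where
  "adj c e k k' x = e \<otimes> x \<ominus> c \<odot> (k \<otimes> x \<otimes> k' \<otimes> e)"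

lemma adj_eigenvector:
  assumes "k \<otimes> x \<otimes> k' = t \<odot> x" "e \<in> carrier B" "x \<in> carrier B"
  shows "adj c e k k' x = e \<otimes> x \<oplus> (- (c * t)) \<odot> (x \<otimes> e)"
  using assms by (simp add: adj_def linear_simps)

lemma conj_mult:
  assumes "k' \<otimes> k = \<one>" "k \<in> carrier B" "k' \<in> carrier B" "x \<in> carrier B" "y \<in> carrier B"
  shows "k \<otimes> (x \<otimes> y) \<otimes> k' = (k \<otimes> x \<otimes> k') \<otimes> (k \<otimes> y \<otimes> k')"
proof -
  have "(k \<otimes> x \<otimes> k') \<otimes> (k \<otimes> y \<otimes> k') = k \<otimes> x \<otimes> (k' \<otimes> k) \<otimes> y \<otimes> k'"
    using assms(2-) by (simp add: m_assoc)
  then show ?thesis using assms by (simp add: m_assoc)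
qed

lemma conj_inverse:
  assumes "k \<otimes> x \<otimes> k' = t \<odot> x" "t \<noteq> 0" "k' \<otimes> k = \<one>"
    and "k \<in> carrier B" "k' \<in> carrier B" "x \<in> carrier B"
  shows "k' \<otimes> x \<otimes> k = inverse t \<odot> x"
proof -
  have "t \<odot> (k' \<otimes> x \<otimes> k) = k' \<otimes> (t \<odot> x) \<otimes> k" using assms by (simp add: smult_mult)
  also have "\<dots> = (k' \<otimes> k) \<otimes> x \<otimes> (k' \<otimes> k)"
    unfolding assms(1)[symmetric] using assms(4-6) by (simp add: m_assoc)
  finally have "t \<odot> (k' \<otimes> x \<otimes> k) = x" using assms by simp
  then have "inverse t \<odot> (t \<odot> (k' \<otimes> x \<otimes> k)) = inverse t \<odot> x" by simp
  then show ?thesis using assms by (simp add: smult_smult)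
qed

text \<open>If \<open>k\<close> acts on \<open>e\<close> and \<open>x\<close> by scalars, then so it does on \<open>e x\<close> and \<open>x e\<close>; two applications of
  \<open>adj\<close> thus give a combination of \<open>e e x\<close>, \<open>e x e\<close> and \<open>x e e\<close>, of which only the middle word
  survives when \<open>e\<close> squares to zero.\<close>

lemma adj_two_fold:
  assumes conj: "k \<otimes> e \<otimes> k' = s \<odot> e" "k \<otimes> x \<otimes> k' = t \<odot> x" "k' \<otimes> k = \<one>"
    and closed: "e \<in> carrier B" "k \<in> carrier B" "k' \<in> carrier B" "x \<in> carrier B"
    and nil: "e \<otimes> e = \<zero>"
  shows "adj d e k k' (adj c e k k' x) = (- (c * t) - d * (s * t)) \<odot> (e \<otimes> (x \<otimes> e))"
proof -
  let ?a = "- (c * t)"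
  have y: "adj c e k k' x = e \<otimes> x \<oplus> ?a \<odot> (x \<otimes> e)"
    using adj_eigenvector[OF conj(2)] closed by simp
  have cy: "k \<otimes> (e \<otimes> x \<oplus> ?a \<odot> (x \<otimes> e)) \<otimes> k' = (s * t) \<odot> (e \<otimes> x \<oplus> ?a \<odot> (x \<otimes> e))"
  proof -
    have "k \<otimes> (e \<otimes> x) \<otimes> k' = (s * t) \<odot> (e \<otimes> x)" "k \<otimes> (x \<otimes> e) \<otimes> k' = (s * t) \<odot> (x \<otimes> e)"
      using conj closed by (simp_all add: conj_mult linear_simps mult.commute)
    then show ?thesis using closed by (simp add: l_distr r_distr linear_simps mult.commute)
  qed
  have nil': "e \<otimes> (e \<otimes> x) = \<zero>" "x \<otimes> (e \<otimes> e) = \<zero>"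
    using nil closed by (simp_all add: m_assoc[symmetric])
  have "adj d e k k' (adj c e k k' x)
      = ?a \<odot> (e \<otimes> (x \<otimes> e)) \<oplus> (- (d * (s * t))) \<odot> (e \<otimes> (x \<otimes> e))"
    unfolding y using adj_eigenvector[OF cy] closed nil nil'
    by (simp add: l_distr r_distr linear_simps m_assoc)
  then show ?thesis using closed by (simp add: smult_add[symmetric])
qed

text \<open>The scalars \<open>c\<close> and \<open>d\<close> are arbitrary, so for the Serre relations of degree two and three the
  parities of the arguments of \<open>Ad\<close> never have to be determined.\<close>

lemma serre_two:
  assumes conj: "k \<otimes> e \<otimes> k' = s \<odot> e" "k \<otimes> x \<otimes> k' = t \<odot> x" "k' \<otimes> k = \<one>"
    and closed: "e \<in> carrier B" "k \<in> carrier B" "k' \<in> carrier B" "x \<in> carrier B"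
    and nil: "e \<otimes> e = \<zero>" "e \<otimes> (x \<otimes> e) = \<zero>"
  shows "adj d e k k' (adj c e k k' x) = \<zero>"
  using adj_two_fold[OF conj closed nil(1)] nil by simp

lemma serre_three:
  assumes conj: "k \<otimes> e \<otimes> k' = s \<odot> e" "k \<otimes> x \<otimes> k' = t \<odot> x" "k' \<otimes> k = \<one>"
    and closed: "e \<in> carrier B" "k \<in> carrier B" "k' \<in> carrier B" "x \<in> carrier B"
    and nil: "e \<otimes> e = \<zero>"
  shows "adj b e k k' (adj d e k k' (adj c e k k' x)) = \<zero>"
proof -
  let ?z = "e \<otimes> (x \<otimes> e)" and ?a = "- (c * t) - d * (s * t)"
  have cz: "k \<otimes> (?a \<odot> ?z) \<otimes> k' = (s * (t * s)) \<odot> (?a \<odot> ?z)"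
    using conj closed by (simp add: conj_mult linear_simps mult_ac)
  have "e \<otimes> ?z = \<zero>" using nil closed by (simp add: m_assoc[symmetric])
  moreover have "?z \<otimes> e = \<zero>" using nil closed by (simp add: m_assoc)
  ultimately show ?thesis
    unfolding adj_two_fold[OF conj closed nil] using adj_eigenvector[OF cz] closed
    by (simp add: smult_mult)
qed

end

section \<open>Realizations of the Clifford relations\<close>

context ratfun_superalgebra
begin

lemma qcomm_of_conj:
  assumes "k \<otimes> x \<otimes> k' = t \<odot> x" "k' \<otimes> k = \<one>" "k \<in> carrier B" "k' \<in> carrier B" "x \<in> carrier B"
  shows "qcomm t k x"
proof -
  have "k \<otimes> x = (k \<otimes> x \<otimes> k') \<otimes> k" using assms(2-) by (simp add: m_assoc)
  also have "\<dots> = t \<odot> (x \<otimes> k)" unfolding assms(1) using assms(3,5) by (simp add: smult_mult)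
  finally show ?thesis by (simp add: qcomm_def)
qed

lemma conj_of_qcomm:
  assumes "qcomm t k x" "k \<otimes> k' = \<one>" "k \<in> carrier B" "k' \<in> carrier B" "x \<in> carrier B"
  shows "k \<otimes> x \<otimes> k' = t \<odot> x"
proof -
  have "k \<otimes> x \<otimes> k' = t \<odot> (x \<otimes> k) \<otimes> k'" using assms(1) by (simp add: qcomm_def)
  also have "\<dots> = t \<odot> x" using assms(2-) by (simp add: smult_mult m_assoc)
  finally show ?thesis .
qed

lemma qcomm_of_anticommute:
  assumes "x \<otimes> y \<oplus> y \<otimes> x = \<zero>" "x \<in> carrier B" "y \<in> carrier B"
  shows "qcomm (- 1) x y"
proof -
  have "\<ominus> (y \<otimes> x) = x \<otimes> y" using assms by (intro minus_equality) auto
  then show ?thesis using assms by (simp add: qcomm_def minus_eq_smult)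
qed

lemma qcomm_self_square:
  assumes "qcomm (- 1) x x" "x \<in> carrier B"
  shows "x \<otimes> x = \<zero>"
proof -
  let ?y = "x \<otimes> x"
  have y: "?y \<in> carrier B" using assms by simp
  have "?y = (- 1) \<odot> ?y" using assms(1) by (simp only: qcomm_def)
  then have "?y \<oplus> ?y = ?y \<oplus> (- 1) \<odot> ?y" by (rule arg_cong)
  then have "(1 + 1) \<odot> ?y = (1 + (- 1)) \<odot> ?y"
    by (simp only: smult_add[OF y] smult_one'[OF y])
  then show ?thesis using smult_eq_zeroD[of "1 + 1" ?y] y by simp
qed

text \<open>Four sign changes cancel.\<close>

lemma qcomm_pairs:
  assumes "qcomm (- 1) a c" "qcomm (- 1) b c" "qcomm (- 1) a d" "qcomm (- 1) b d"
    and "a \<in> carrier B" "b \<in> carrier B" "c \<in> carrier B" "d \<in> carrier B"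
  shows "qcomm 1 (a \<otimes> b) (c \<otimes> d)"
  using qcomm_mult_right[OF qcomm_mult_left[OF assms(1,2)] qcomm_mult_left[OF assms(3,4)]] assms(5-)
  by simp

lemma linear_combination_add:
  assumes "x \<in> carrier B" "y \<in> carrier B"
  shows "(a \<odot> x \<oplus> b \<odot> y) \<oplus> (c \<odot> x \<oplus> d \<odot> y) = (a + c) \<odot> x \<oplus> (b + d) \<odot> y"
  using assms by (simp add: smult_add a_ac)

end

text \<open>All computations take place in an arbitrary superalgebra with elements that satisfy the defining
  relations of the deformed Clifford algebra; \<open>\<psi>' i\<close> stands for \<open>\<psi>\<^sub>i\<^sup>\<dagger>\<close> and \<open>v' i\<close> for the inverse of
  \<open>v\<^sub>i\<close>.\<close>

locale clifford_generators = ratfun_superalgebra B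
  for B :: "(ratfun, 'b, 'm) superalgebra_scheme" (structure) +
  fixes n :: nat and \<psi> \<psi>' v v' :: "nat \<Rightarrow> 'b"
  assumes parities: "i \<in> {1..n} \<Longrightarrow> \<psi> i \<in> component B 1" "i \<in> {1..n} \<Longrightarrow> \<psi>' i \<in> component B 1"
      "i \<in> {1..n} \<Longrightarrow> v i \<in> component B 0" "i \<in> {1..n} \<Longrightarrow> v' i \<in> component B 0"
    and v_comm: "\<lbrakk>i \<in> {1..n}; j \<in> {1..n}\<rbrakk> \<Longrightarrow> v i \<otimes> v j = v j \<otimes> v i"
    and v_inverse: "i \<in> {1..n} \<Longrightarrow> v i \<otimes> v' i = \<one>" "i \<in> {1..n} \<Longrightarrow> v' i \<otimes> v i = \<one>"
    and v_\<psi>: "\<lbrakk>i \<in> {1..n}; j \<in> {1..n}\<rbrakk> \<Longrightarrow>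
      v i \<otimes> \<psi> j \<otimes> v' i = (qq powi (if i = j then 1 else 0)) \<odot> \<psi> j"
    and v_\<psi>': "\<lbrakk>i \<in> {1..n}; j \<in> {1..n}\<rbrakk> \<Longrightarrow>
      v i \<otimes> \<psi>' j \<otimes> v' i = (qq powi (- (if i = j then 1 else 0))) \<odot> \<psi>' j"
    and \<psi>_\<psi>: "\<lbrakk>i \<in> {1..n}; j \<in> {1..n}\<rbrakk> \<Longrightarrow> \<psi> i \<otimes> \<psi> j \<oplus> \<psi> j \<otimes> \<psi> i = \<zero>"
    and \<psi>'_\<psi>': "\<lbrakk>i \<in> {1..n}; j \<in> {1..n}\<rbrakk> \<Longrightarrow> \<psi>' i \<otimes> \<psi>' j \<oplus> \<psi>' j \<otimes> \<psi>' i = \<zero>"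
    and \<psi>_\<psi>': "\<lbrakk>i \<in> {1..n}; j \<in> {1..n}; i \<noteq> j\<rbrakk> \<Longrightarrow> \<psi> i \<otimes> \<psi>' j \<oplus> \<psi>' j \<otimes> \<psi> i = \<zero>"
    and \<psi>_\<psi>'_q: "i \<in> {1..n} \<Longrightarrow> \<psi> i \<otimes> \<psi>' i \<oplus> qq \<odot> (\<psi>' i \<otimes> \<psi> i) = v' i"
    and \<psi>_\<psi>'_q_inv: "i \<in> {1..n} \<Longrightarrow> \<psi> i \<otimes> \<psi>' i \<oplus> inverse qq \<odot> (\<psi>' i \<otimes> \<psi> i) = v i"
begin

lemma generators_closed [simp]:
  "i \<in> {1..n} \<Longrightarrow> \<psi> i \<in> carrier B" "i \<in> {1..n} \<Longrightarrow> \<psi>' i \<in> carrier B"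
  "i \<in> {1..n} \<Longrightarrow> v i \<in> carrier B" "i \<in> {1..n} \<Longrightarrow> v' i \<in> carrier B"
  using parities component_closed by blast+

lemma anticommute:
  "i \<in> {1..n} \<Longrightarrow> j \<in> {1..n} \<Longrightarrow> qcomm (- 1) (\<psi> i) (\<psi> j)"
  "i \<in> {1..n} \<Longrightarrow> j \<in> {1..n} \<Longrightarrow> qcomm (- 1) (\<psi>' i) (\<psi>' j)"
  "i \<in> {1..n} \<Longrightarrow> j \<in> {1..n} \<Longrightarrow> i \<noteq> j \<Longrightarrow> qcomm (- 1) (\<psi> i) (\<psi>' j)"
  "i \<in> {1..n} \<Longrightarrow> j \<in> {1..n} \<Longrightarrow> i \<noteq> j \<Longrightarrow> qcomm (- 1) (\<psi>' i) (\<psi> j)"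
  using \<psi>_\<psi>[of i j] \<psi>'_\<psi>'[of i j] \<psi>_\<psi>'[of i j] \<psi>_\<psi>'[of j i]
  by (simp_all add: qcomm_of_anticommute a_comm)

lemma squares_zero:
  "i \<in> {1..n} \<Longrightarrow> \<psi> i \<otimes> \<psi> i = \<zero>" "i \<in> {1..n} \<Longrightarrow> \<psi>' i \<otimes> \<psi>' i = \<zero>"
  using anticommute[of i i] by (simp_all add: qcomm_self_square)

lemma v_qcomm:
  assumes "i \<in> {1..n}" "j \<in> {1..n}"
  shows "qcomm 1 (v i) (v j)" "qcomm 1 (v i) (v' j)" "qcomm 1 (v' i) (v j)" "qcomm 1 (v' i) (v' j)"
proof -
  show vv: "qcomm 1 (v i) (v j)" using assms v_comm[of i j] by (simp add: qcomm_def)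
  show v'v: "qcomm 1 (v' i) (v j)"
    using qcomm_of_inverse[OF vv _ v_inverse] assms by simp
  have "qcomm 1 (v' j) (v i)"
    using qcomm_of_inverse[of 1 "v j" "v i" "v' j"] v_inverse assms v_comm[of j i] by (simp add: qcomm_def)
  then show "qcomm 1 (v i) (v' j)" using assms by (simp add: qcomm_def)
  then show "qcomm 1 (v' i) (v' j)"
    using qcomm_of_inverse[of 1 "v i" "v' j" "v' i"] v_inverse assms by simp
qed

text \<open>Weights turn conjugation by the \<open>v\<^sub>i\<close> into addition of integer vectors.\<close>

definition weight :: "(nat \<Rightarrow> int) \<Rightarrow> 'b \<Rightarrow> bool" where
  "weight \<mu> x \<longleftrightarrow> x \<in> carrier B \<and> (\<forall>i \<in> {1..n}. qcomm (qq powi \<mu> i) (v i) x)"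

lemma weight_mult: "weight \<mu> x \<Longrightarrow> weight \<nu> y \<Longrightarrow> weight (\<lambda>i. \<mu> i + \<nu> i) (x \<otimes> y)"
  by (simp add: weight_def power_int_add qcomm_mult_right)

lemma weight_smult: "weight \<mu> x \<Longrightarrow> weight \<mu> (c \<odot> x)"
  by (simp add: weight_def qcomm_smult_right)

lemma weight_\<psi>:
  assumes j: "j \<in> {1..n}" shows "weight (\<lambda>i. of_bool (i = j)) (\<psi> j)"
  unfolding weight_def
proof (intro conjI ballI)
  show "\<psi> j \<in> carrier B" using j by simp
  fix i assume i: "i \<in> {1..n}"
  show "qcomm (qq powi (of_bool (i = j))) (v i) (\<psi> j)"
    using qcomm_of_conj[OF v_\<psi>[OF i j] v_inverse(2)[OF i]] i j
    by (simp only: of_bool_def generators_closed)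
qed

lemma weight_\<psi>':
  assumes j: "j \<in> {1..n}" shows "weight (\<lambda>i. - of_bool (i = j)) (\<psi>' j)"
  unfolding weight_def
proof (intro conjI ballI)
  show "\<psi>' j \<in> carrier B" using j by simp
  fix i assume i: "i \<in> {1..n}"
  show "qcomm (qq powi (- of_bool (i = j))) (v i) (\<psi>' j)"
    using qcomm_of_conj[OF v_\<psi>'[OF i j] v_inverse(2)[OF i]] i j
    by (simp only: of_bool_def generators_closed)
qed

section \<open>The images of the Chevalley generators\<close>

definition e :: "nat \<Rightarrow> 'b" where
  "e i = (if i < n then \<psi> i \<otimes> \<psi>' (i + 1) else (imag_unit * inverse (qh - inverse qh)) \<odot> \<psi> n)"

definition f :: "nat \<Rightarrow> 'b" where
  "f i = (if i < n then \<psi> (i + 1) \<otimes> \<psi>' i else \<psi>' n)"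

definition k :: "nat \<Rightarrow> 'b" where
  "k i = (if i < n then v i \<otimes> v' (i + 1) else (imag_unit * qh) \<odot> v n)"

definition k' :: "nat \<Rightarrow> 'b" where
  "k' i = (if i < n then v (i + 1) \<otimes> v' i else inverse (imag_unit * qh) \<odot> v' n)"

lemma index_cases:
  assumes "i \<in> {1..n}"
  obtains (inner) "i < n" "i + 1 \<in> {1..n}" | (last) "i = n"
  using assms by fastforce

lemma images_parity:
  assumes "i \<in> {1..n}"
  shows "e i \<in> component B (if i = n then 1 else 0)" "f i \<in> component B (if i = n then 1 else 0)"
    "k i \<in> component B 0" "k' i \<in> component B 0"
proof -
  have "e i \<in> component B (if i = n then 1 else 0) \<and> f i \<in> component B (if i = n then 1 else 0)
      \<and> k i \<in> component B 0 \<and> k' i \<in> component B 0"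
    using assms
  proof (cases rule: index_cases)
    case inner
    then show ?thesis
      using component_mult[of "\<psi> i" 1 "\<psi>' (i + 1)" 1] component_mult[of "\<psi> (i + 1)" 1 "\<psi>' i" 1]
        component_mult[of "v i" 0 "v' (i + 1)" 0] component_mult[of "v (i + 1)" 0 "v' i" 0]
        parities assms by (simp add: e_def f_def k_def k'_def)
  next
    case last
    then show ?thesis
      using component_smult parities assms by (simp add: e_def f_def k_def k'_def)
  qed
  then show "e i \<in> component B (if i = n then 1 else 0)" "f i \<in> component B (if i = n then 1 else 0)"
    "k i \<in> component B 0" "k' i \<in> component B 0" by blast+
qed

lemma images_closed [simp]:
  "i \<in> {1..n} \<Longrightarrow> e i \<in> carrier B" "i \<in> {1..n} \<Longrightarrow> f i \<in> carrier B"
  "i \<in> {1..n} \<Longrightarrow> k i \<in> carrier B" "i \<in> {1..n} \<Longrightarrow> k' i \<in> carrier B"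
  using images_parity component_closed by blast+

lemma k_inverse:
  assumes i: "i \<in> {1..n}"
  shows "k i \<otimes> k' i = \<one>" "k' i \<otimes> k i = \<one>"
proof -
  have "k i \<otimes> k' i = \<one> \<and> k' i \<otimes> k i = \<one>"
    using i
  proof (cases rule: index_cases)
    case inner
    let ?j = "i + 1"
    have "k i \<otimes> k' i = v i \<otimes> (v' ?j \<otimes> v ?j) \<otimes> v' i"
      "k' i \<otimes> k i = v ?j \<otimes> (v' i \<otimes> v i) \<otimes> v' ?j"
      using i inner by (simp_all add: k_def k'_def m_assoc)
    then show ?thesis using i inner v_inverse by simp
  next
    case last
    then show ?thesis
      using i v_inverse[of n]
      by (simp add: k_def k'_def smult_mult smult_smult del: inverse_mult_distrib)
  qed
  then show "k i \<otimes> k' i = \<one>" "k' i \<otimes> k i = \<one>" by blast+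
qed

lemma k_comm:
  assumes i: "i \<in> {1..n}" and j: "j \<in> {1..n}"
  shows "k i \<otimes> k j = k j \<otimes> k i"
proof -
  have vk: "qcomm 1 (v i) (k j) \<and> qcomm 1 (v' i) (k j)" if i: "i \<in> {1..n}" for i
    using j
  proof (cases rule: index_cases)
    case inner
    then show ?thesis
      using i j qcomm_mult_right[of 1 "v i" "v j" 1 "v' (j + 1)"] v_qcomm
        qcomm_mult_right[of 1 "v' i" "v j" 1 "v' (j + 1)"] by (simp add: k_def)
  next
    case last
    then show ?thesis using i j v_qcomm by (simp add: k_def qcomm_smult_right)
  qed
  have "qcomm 1 (k i) (k j)"
    using i
  proof (cases rule: index_cases)
    case inner
    then show ?thesis
      using i j qcomm_mult_left[of 1 "v i" "k j" 1 "v' (i + 1)"] vk by (simp add: k_def)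
  next
    case last
    then have "k i = (imag_unit * qh) \<odot> v n" by (simp add: k_def)
    then show ?thesis using i j vk last by (simp add: qcomm_smult_left)
  qed
  then show ?thesis by (rule qcomm_one) (use i j in simp_all)
qed

text \<open>In coordinates the simple roots of \<open>osp(1|2n)\<close> are \<open>\<epsilon>\<^sub>j - \<epsilon>\<^bsub>j+1\<^esub>\<close> for \<open>j < n\<close> and \<open>\<epsilon>\<^sub>n\<close>. A single
  formula covers both: for \<open>j = n\<close> the second term sits at the coordinate \<open>n + 1\<close>, which is never
  evaluated.\<close>

definition simple_root :: "nat \<Rightarrow> nat \<Rightarrow> int" where
  "simple_root j i = of_bool (i = j) - of_bool (i = j + 1)"

lemma weight_cong: "weight \<mu> x \<Longrightarrow> (\<And>i. i \<in> {1..n} \<Longrightarrow> \<mu> i = \<nu> i) \<Longrightarrow> weight \<nu> x"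
  by (auto simp: weight_def)

lemma weight_e:
  assumes j: "j \<in> {1..n}"
  shows "weight (simple_root j) (e j)"
  using j
proof (cases rule: index_cases)
  case inner
  have "weight (simple_root j) (\<psi> j \<otimes> \<psi>' (j + 1))"
    by (rule weight_cong[OF weight_mult[OF weight_\<psi>[OF j] weight_\<psi>'[OF inner(2)]]])
      (simp add: simple_root_def)
  then show ?thesis using inner by (simp add: e_def)
next
  case last
  have "weight (simple_root n) (c \<odot> \<psi> n)" for c
    by (rule weight_cong[OF weight_smult[OF weight_\<psi>]]) (use j last in \<open>auto simp: simple_root_def\<close>)
  then show ?thesis using last by (simp add: e_def)
qed

lemma weight_f:
  assumes j: "j \<in> {1..n}"
  shows "weight (\<lambda>i. - simple_root j i) (f j)"
  using j
proof (cases rule: index_cases)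
  case inner
  have "weight (\<lambda>i. - simple_root j i) (\<psi> (j + 1) \<otimes> \<psi>' j)"
    by (rule weight_cong[OF weight_mult[OF weight_\<psi>[OF inner(2)] weight_\<psi>'[OF j]]])
      (simp add: simple_root_def)
  then show ?thesis using inner by (simp add: f_def)
next
  case last
  have "weight (\<lambda>i. - simple_root n i) (\<psi>' n)"
    by (rule weight_cong[OF weight_\<psi>']) (use j last in \<open>auto simp: simple_root_def\<close>)
  then show ?thesis using last by (simp add: f_def)
qed

lemma k_conj:
  assumes x: "weight \<mu> x" and i: "i \<in> {1..n}"
  shows "k i \<otimes> x \<otimes> k' i = (qq powi (if i < n then \<mu> i - \<mu> (i + 1) else \<mu> n)) \<odot> x"
proof -
  have xc: "x \<in> carrier B" using x by (simp add: weight_def)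
  have v: "qcomm (qq powi \<mu> l) (v l) x" "qcomm (inverse (qq powi \<mu> l)) (v' l) x" if l: "l \<in> {1..n}" for l
  proof -
    show *: "qcomm (qq powi \<mu> l) (v l) x" using x l by (simp add: weight_def)
    show "qcomm (inverse (qq powi \<mu> l)) (v' l) x"
      using qcomm_of_inverse[OF * _ v_inverse] l xc by simp
  qed
  have "qcomm (qq powi (if i < n then \<mu> i - \<mu> (i + 1) else \<mu> n)) (k i) x"
    using i
  proof (cases rule: index_cases)
    case inner
    then show ?thesis
      using i xc qcomm_mult_left[OF v(1)[of i] v(2)[of "i + 1"]]
      by (simp add: k_def power_int_diff divide_inverse)
  next
    case last
    then show ?thesis using i xc qcomm_smult_left[OF v(1)[of n]] by (simp add: k_def)
  qed
  then show ?thesis using conj_of_qcomm k_inverse i xc by simp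
qed

text \<open>The symmetrized Cartan matrix \<open>d\<^sub>i a\<^sub>i\<^sub>j\<close> is the Gram matrix of the simple roots; for \<open>i = n\<close> the
  factor \<open>q\<^sub>n = q\<^sup>1\<^sup>/\<^sup>2\<close> halves the entries 2 and -2.\<close>

lemma root_pairing:
  assumes "i \<in> {1..n}" "j \<in> {1..n}"
  shows "qi n i powi cartan n i j = qq powi (if i < n then simple_root j i - simple_root j (i + 1) else simple_root j n)"
proof -
  have h: "qh powi 2 = qq" "qh powi (- 2) = inverse qq"
    by (simp_all add: qq_def power_int_minus)
  show ?thesis using assms h
    by (auto simp: qi_def cartan_def simple_root_def power_int_minus)
qed

lemma k_e:
  assumes "i \<in> {1..n}" "j \<in> {1..n}"
  shows "k i \<otimes> e j \<otimes> k' i = (qi n i powi cartan n i j) \<odot> e j"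
  unfolding root_pairing[OF assms] using k_conj[OF weight_e] assms by simp

lemma k_f:
  assumes "i \<in> {1..n}" "j \<in> {1..n}"
  shows "k i \<otimes> f j \<otimes> k' i = (qi n i powi (- cartan n i j)) \<odot> f j"
  unfolding power_int_minus root_pairing[OF assms]
  using k_conj[OF weight_f] assms by (simp flip: power_int_minus)

end

section \<open>The relations between positive and negative generators\<close>

lemma (in ratfun_superalgebra) linear_combination_mult:
  assumes "x \<in> carrier B" "y \<in> carrier B" "z \<in> carrier B" "w \<in> carrier B"
  shows "(a \<odot> x \<oplus> b \<odot> y) \<otimes> (c \<odot> z \<oplus> d \<odot> w)
    = ((a * c) \<odot> (x \<otimes> z) \<oplus> (a * d) \<odot> (x \<otimes> w)) \<oplus> ((b * c) \<odot> (y \<otimes> z) \<oplus> (b * d) \<odot> (y \<otimes> w))"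
  using assms by (simp add: l_distr r_distr smult_mult smult_smult smult_distr a_ac mult.commute)

context clifford_generators
begin

text \<open>A letter \<open>\<psi>\<close> can fail to anticommute with a letter \<open>\<psi>'\<close> only if they have the same index. The \<open>\<psi>\<close>
  of \<open>e i\<close> has index \<open>i\<close> and the \<open>\<psi>'\<close> of \<open>f j\<close> has index \<open>j\<close>, and the remaining letters have indices
  \<open>i + 1\<close> and \<open>j + 1\<close>, so for \<open>i \<noteq> j\<close> all letters anticommute.\<close>

lemma qcomm_e_f:
  assumes i: "i \<in> {1..n}" and j: "j \<in> {1..n}" and "i \<noteq> j"
  shows "qcomm 1 (e i) (f j)"
  using i
proof (cases rule: index_cases)
  case inner
  note ei = inner
  show ?thesis using j
  proof (cases rule: index_cases)
    case inner
    have "qcomm 1 (\<psi> i \<otimes> \<psi>' (i + 1)) (\<psi> (j + 1) \<otimes> \<psi>' j)"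
      using i j ei inner \<open>i \<noteq> j\<close> by (intro qcomm_pairs anticommute generators_closed) auto
    then show ?thesis using ei inner by (simp add: e_def f_def)
  next
    case last
    have "qcomm ((- 1) * (- 1)) (\<psi> i \<otimes> \<psi>' (i + 1)) (\<psi>' n)"
      using i j ei last \<open>i \<noteq> j\<close> by (intro qcomm_mult_left anticommute generators_closed) auto
    then show ?thesis using ei last by (simp add: e_def f_def)
  qed
next
  case last
  have jn: "j < n" "j + 1 \<in> {1..n}" using j last \<open>i \<noteq> j\<close> by auto
  have "qcomm ((- 1) * (- 1)) (\<psi> n) (\<psi> (j + 1) \<otimes> \<psi>' j)"
    using i j jn last by (intro qcomm_mult_right anticommute generators_closed) auto
  then have "qcomm 1 (c \<odot> \<psi> n) (\<psi> (j + 1) \<otimes> \<psi>' j)" for c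
    using i j jn last by (intro qcomm_smult_left) auto
  then show ?thesis using jn last by (simp add: e_def f_def)
qed

abbreviation r :: ratfun where "r \<equiv> 1 / (qq - inverse qq)"

text \<open>The difference of the two deformed relations eliminates \<open>\<psi> \<psi>'\<close>.\<close>

lemma \<psi>'_\<psi>_eq:
  assumes i: "i \<in> {1..n}"
  shows "\<psi>' i \<otimes> \<psi> i = r \<odot> v' i \<oplus> (- r) \<odot> v i"
proof -
  let ?x = "\<psi> i \<otimes> \<psi>' i" and ?y = "\<psi>' i \<otimes> \<psi> i"
  have c: "?x \<in> carrier B" "?y \<in> carrier B" using i by simp_all
  have "v' i \<oplus> (- 1) \<odot> v i
      = (1 \<odot> ?x \<oplus> qq \<odot> ?y) \<oplus> ((- 1) \<odot> ?x \<oplus> (- inverse qq) \<odot> ?y)"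
    unfolding \<psi>_\<psi>'_q[OF i, symmetric] \<psi>_\<psi>'_q_inv[OF i, symmetric] using c
    by (simp add: smult_distr smult_smult)
  also have "\<dots> = (qq - inverse qq) \<odot> ?y"
    unfolding linear_combination_add[OF c] using c by simp
  finally have "r \<odot> (v' i \<oplus> (- 1) \<odot> v i) = ?y"
    using c qq_minus_inverse_neq_0 by (simp add: smult_smult)
  then show ?thesis using i by (simp add: smult_distr smult_smult)
qed

lemma \<psi>_\<psi>'_eq:
  assumes i: "i \<in> {1..n}"
  shows "\<psi> i \<otimes> \<psi>' i = (r * qq) \<odot> v i \<oplus> (- (r * inverse qq)) \<odot> v' i"
proof -
  let ?x = "\<psi> i \<otimes> \<psi>' i" and ?y = "\<psi>' i \<otimes> \<psi> i"
  have c: "?x \<in> carrier B" "?y \<in> carrier B" "v i \<in> carrier B" "v' i \<in> carrier B" using i by simp_all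
  have "?x = (1 \<odot> ?x \<oplus> qq \<odot> ?y) \<oplus> (0 \<odot> ?x \<oplus> (- qq) \<odot> ?y)"
    unfolding linear_combination_add[OF c(1,2)] using c by simp
  also have "\<dots> = (0 \<odot> v i \<oplus> 1 \<odot> v' i) \<oplus> (- qq) \<odot> ?y"
    using c \<psi>_\<psi>'_q[OF i] by simp
  also have "\<dots> = (0 \<odot> v i \<oplus> 1 \<odot> v' i) \<oplus> ((r * qq) \<odot> v i \<oplus> (- (r * qq)) \<odot> v' i)"
    unfolding \<psi>'_\<psi>_eq[OF i] using c by (simp add: smult_distr smult_smult mult.commute a_comm)
  also have "\<dots> = (0 + r * qq) \<odot> v i \<oplus> (1 + - (r * qq)) \<odot> v' i"
    by (rule linear_combination_add[OF c(3,4)])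
  also have "1 + - (r * qq) = - (r * inverse qq)"
    using qq_minus_inverse_neq_0 by (simp add: divide_simps)
  finally show ?thesis by simp
qed

text \<open>Since \<open>\<psi>' j \<psi> j\<close> is even, \<open>e i f i = (\<psi> i \<psi>' i) (\<psi>' j \<psi> j)\<close> for \<open>j = i + 1\<close>, and \<open>f i e i\<close> arises by
  exchanging \<open>i\<close> and \<open>j\<close>. Both factors are linear in \<open>v\<close> and \<open>v'\<close>, so each side becomes a combination of
  the four products \<open>x1\<close>, ..., \<open>x4\<close>. The terms \<open>x2 = v i v j\<close> and \<open>x3 = v' i v' j\<close> are symmetric
  in \<open>i\<close> and \<open>j\<close> and cancel; the other two are \<open>k i\<close> and \<open>k' i\<close>, with coefficient
  \<open>r\<^sup>2 (q - q\<^sup>-\<^sup>1) = r\<close> up to sign.\<close>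

lemma e_f_inner:
  assumes i: "i \<in> {1..n}" and j: "i + 1 \<in> {1..n}"
  shows "e i \<otimes> f i \<ominus> f i \<otimes> e i = r \<odot> (k i \<ominus> k' i)"
proof -
  let ?j = "i + 1"
  let ?x1 = "v i \<otimes> v' ?j" and ?x2 = "v i \<otimes> v ?j" and ?x3 = "v' i \<otimes> v' ?j" and ?x4 = "v ?j \<otimes> v' i"
  let ?\<alpha> = "r * qq * r" and ?\<beta> = "r * inverse qq * r"
  have c: "?x1 \<in> carrier B" "?x2 \<in> carrier B" "?x3 \<in> carrier B" "?x4 \<in> carrier B"
    using i j by simp_all
  have cv: "v i \<in> carrier B" "v' i \<in> carrier B" "v ?j \<in> carrier B" "v' ?j \<in> carrier B"
    using i j by simp_all
  have comm: "v ?j \<otimes> v i = ?x2" "v' ?j \<otimes> v' i = ?x3" "v' i \<otimes> v ?j = ?x4" "v' ?j \<otimes> v i = ?x1"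
    using i j v_qcomm[of ?j i] v_qcomm[of i ?j] by (simp_all only: qcomm_one generators_closed)
  have ij: "i < n" using j by simp
  have "qcomm ((- 1) * (- 1)) (\<psi>' ?j \<otimes> \<psi> ?j) (\<psi>' i)" "qcomm ((- 1) * (- 1)) (\<psi>' i \<otimes> \<psi> i) (\<psi>' ?j)"
    using i j by (intro qcomm_mult_left anticommute generators_closed; simp)+
  then have sw: "(\<psi>' ?j \<otimes> \<psi> ?j) \<otimes> \<psi>' i = \<psi>' i \<otimes> (\<psi>' ?j \<otimes> \<psi> ?j)"
      "(\<psi>' i \<otimes> \<psi> i) \<otimes> \<psi>' ?j = \<psi>' ?j \<otimes> (\<psi>' i \<otimes> \<psi> i)"
    using i j by (simp_all add: qcomm_def)
  have "e i \<otimes> f i = \<psi> i \<otimes> ((\<psi>' ?j \<otimes> \<psi> ?j) \<otimes> \<psi>' i)"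
    using i j ij by (simp add: e_def f_def m_assoc)
  also have "\<dots> = (\<psi> i \<otimes> \<psi>' i) \<otimes> (\<psi>' ?j \<otimes> \<psi> ?j)"
    unfolding sw using i j by (simp add: m_assoc)
  also have "\<dots> = (?\<alpha> \<odot> ?x1 \<oplus> (- ?\<alpha>) \<odot> ?x2) \<oplus> ((- ?\<beta>) \<odot> ?x3 \<oplus> ?\<beta> \<odot> ?x4)"
    unfolding \<psi>'_\<psi>_eq[OF j] \<psi>_\<psi>'_eq[OF i] linear_combination_mult[OF cv(1,2,4,3)] comm(3)
    by (simp only: mult_minus_left mult_minus_right Groups.minus_minus)
  finally have ef: "e i \<otimes> f i = (?\<alpha> \<odot> ?x1 \<oplus> (- ?\<alpha>) \<odot> ?x2) \<oplus> ((- ?\<beta>) \<odot> ?x3 \<oplus> ?\<beta> \<odot> ?x4)" .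
  have "f i \<otimes> e i = \<psi> ?j \<otimes> ((\<psi>' i \<otimes> \<psi> i) \<otimes> \<psi>' ?j)"
    using i j ij by (simp add: e_def f_def m_assoc)
  also have "\<dots> = (\<psi> ?j \<otimes> \<psi>' ?j) \<otimes> (\<psi>' i \<otimes> \<psi> i)"
    unfolding sw using i j by (simp add: m_assoc)
  also have "\<dots> = (?\<alpha> \<odot> ?x4 \<oplus> (- ?\<alpha>) \<odot> ?x2) \<oplus> ((- ?\<beta>) \<odot> ?x3 \<oplus> ?\<beta> \<odot> ?x1)"
    unfolding \<psi>'_\<psi>_eq[OF i] \<psi>_\<psi>'_eq[OF j] linear_combination_mult[OF cv(3,4,2,1)] comm(1,2,4)
    by (simp only: mult_minus_left mult_minus_right Groups.minus_minus)
  also have "\<dots> = (?\<beta> \<odot> ?x1 \<oplus> (- ?\<alpha>) \<odot> ?x2) \<oplus> ((- ?\<beta>) \<odot> ?x3 \<oplus> ?\<alpha> \<odot> ?x4)"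
    using c by (simp add: a_ac)
  finally have fe: "f i \<otimes> e i = (?\<beta> \<odot> ?x1 \<oplus> (- ?\<alpha>) \<odot> ?x2) \<oplus> ((- ?\<beta>) \<odot> ?x3 \<oplus> ?\<alpha> \<odot> ?x4)" .
  have "e i \<otimes> f i \<ominus> f i \<otimes> e i
      = ((?\<alpha> \<odot> ?x1 \<oplus> (- ?\<alpha>) \<odot> ?x2) \<oplus> ((- ?\<beta>) \<odot> ?x1 \<oplus> ?\<alpha> \<odot> ?x2))
      \<oplus> (((- ?\<beta>) \<odot> ?x3 \<oplus> ?\<beta> \<odot> ?x4) \<oplus> (?\<beta> \<odot> ?x3 \<oplus> (- ?\<alpha>) \<odot> ?x4))"
    unfolding ef fe using c by (simp add: diff_eq_smult smult_distr smult_smult a_ac)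
  also have "\<dots> = (?\<alpha> - ?\<beta>) \<odot> ?x1 \<oplus> (- (?\<alpha> - ?\<beta>)) \<odot> ?x4"
    unfolding linear_combination_add[OF c(1,2)] linear_combination_add[OF c(3,4)] using c by simp
  also have "?\<alpha> - ?\<beta> = r"
  proof -
    have "?\<alpha> - ?\<beta> = (r * (qq - inverse qq)) * r" by (simp only: algebra_simps)
    then show ?thesis using qq_minus_inverse_neq_0 by simp
  qed
  finally show ?thesis using i j ij c by (simp add: k_def k'_def diff_eq_smult smult_distr smult_smult)
qed

text \<open>Here the constant in \<open>e n\<close> is what makes the coefficients match: with \<open>c = \<i> / (q\<^sup>1\<^sup>/\<^sup>2 - q\<^sup>-\<^sup>1\<^sup>/\<^sup>2)\<close> one
  has \<open>c (q - 1) = \<i> q\<^sup>1\<^sup>/\<^sup>2\<close> and \<open>c (1 - q\<^sup>-\<^sup>1) = \<i> q\<^sup>-\<^sup>1\<^sup>/\<^sup>2\<close>, and the second value is minus the inverse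
  of the first.\<close>

lemma e_f_last:
  assumes i: "n \<in> {1..n}"
  shows "e n \<otimes> f n \<oplus> f n \<otimes> e n = r \<odot> (k n \<ominus> k' n)"
proof -
  let ?c = "imag_unit * inverse (qh - inverse qh)"
  have c: "v n \<in> carrier B" "v' n \<in> carrier B" using i by simp_all
  have "e n \<otimes> f n \<oplus> f n \<otimes> e n = ?c \<odot> (\<psi> n \<otimes> \<psi>' n \<oplus> \<psi>' n \<otimes> \<psi> n)"
    using i by (simp add: e_def f_def smult_mult smult_distr)
  also have "\<psi> n \<otimes> \<psi>' n \<oplus> \<psi>' n \<otimes> \<psi> n
      = ((r * qq) \<odot> v n \<oplus> (- (r * inverse qq)) \<odot> v' n) \<oplus> ((- r) \<odot> v n \<oplus> r \<odot> v' n)"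
    unfolding \<psi>'_\<psi>_eq[OF i] \<psi>_\<psi>'_eq[OF i] using c by (simp add: a_comm)
  also have "\<dots> = (r * qq + - r) \<odot> v n \<oplus> (- (r * inverse qq) + r) \<odot> v' n"
    by (rule linear_combination_add[OF c])
  also have "?c \<odot> \<dots> = (?c * (r * qq + - r)) \<odot> v n \<oplus> (?c * (- (r * inverse qq) + r)) \<odot> v' n"
    using c by (simp add: smult_distr smult_smult)
  also have "?c * (r * qq + - r) = r * (imag_unit * qh)"
  proof -
    have "qh - inverse qh \<noteq> 0" using qq_neq_1 by (auto simp: qq_def power2_eq_square field_simps)
    then have "inverse (qh - inverse qh) * (qq - 1) = qh"
      by (simp add: qq_def power2_eq_square field_simps)
    then have "imag_unit * r * (inverse (qh - inverse qh) * (qq - 1)) = imag_unit * r * qh" by simp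
    then show ?thesis by (simp add: algebra_simps)
  qed
  also have "?c * (- (r * inverse qq) + r) = - (r * inverse (imag_unit * qh))"
  proof -
    have "qh - inverse qh \<noteq> 0" using qq_neq_1 by (auto simp: qq_def power2_eq_square field_simps)
    then have "inverse (qh - inverse qh) * (1 - inverse qq) = inverse qh"
      by (simp add: qq_def power2_eq_square field_simps)
    then have "imag_unit * r * (inverse (qh - inverse qh) * (1 - inverse qq)) = imag_unit * r * inverse qh"
      by simp
    then show ?thesis by (simp add: algebra_simps inverse_imag_unit)
  qed
  finally show ?thesis using c by (simp add: k_def k'_def diff_eq_smult smult_distr smult_smult)
qed

section \<open>The Serre relations\<close>

lemma e_f_square:
  assumes i: "i \<in> {1..n}"
  shows "e i \<otimes> e i = \<zero>" "f i \<otimes> f i = \<zero>"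
proof -
  have "e i \<otimes> e i = \<zero> \<and> f i \<otimes> f i = \<zero>"
    using i
  proof (cases rule: index_cases)
    case inner
    let ?j = "i + 1"
    have "\<psi> i \<otimes> (\<psi>' ?j \<otimes> \<psi> i) = \<zero>" "\<psi> ?j \<otimes> (\<psi>' i \<otimes> \<psi> ?j) = \<zero>"
      using i inner by (auto intro!: qcomm_sandwich anticommute squares_zero)
    moreover have "e i \<otimes> e i = (\<psi> i \<otimes> (\<psi>' ?j \<otimes> \<psi> i)) \<otimes> \<psi>' ?j"
      "f i \<otimes> f i = (\<psi> ?j \<otimes> (\<psi>' i \<otimes> \<psi> ?j)) \<otimes> \<psi>' i"
      using i inner by (simp_all add: e_def f_def m_assoc)
    ultimately show ?thesis using i inner by simp
  next
    case last
    then show ?thesis using i squares_zero[of n] by (simp add: e_def f_def smult_mult smult_smult)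
  qed
  then show "e i \<otimes> e i = \<zero>" "f i \<otimes> f i = \<zero>" by blast+
qed

lemma qcomm_letters:
  assumes l: "l \<in> {1..n}" and j: "j \<in> {1..n}"
  shows "l \<noteq> j + 1 \<Longrightarrow> \<exists>s. qcomm s (\<psi> l) (e j)" "l \<noteq> j \<Longrightarrow> \<exists>s. qcomm s (\<psi>' l) (e j)"
    "l \<noteq> j \<Longrightarrow> \<exists>s. qcomm s (\<psi> l) (f j)" "l \<noteq> j + 1 \<Longrightarrow> \<exists>s. qcomm s (\<psi>' l) (f j)"
proof -
  have "(l \<noteq> j + 1 \<longrightarrow> (\<exists>s. qcomm s (\<psi> l) (e j))) \<and> (l \<noteq> j \<longrightarrow> (\<exists>s. qcomm s (\<psi>' l) (e j)))
     \<and> (l \<noteq> j \<longrightarrow> (\<exists>s. qcomm s (\<psi> l) (f j))) \<and> (l \<noteq> j + 1 \<longrightarrow> (\<exists>s. qcomm s (\<psi>' l) (f j)))"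
    using j
  proof (cases rule: index_cases)
    case inner
    have "l \<noteq> j + 1 \<Longrightarrow> qcomm ((- 1) * (- 1)) (\<psi> l) (\<psi> j \<otimes> \<psi>' (j + 1))"
      "l \<noteq> j \<Longrightarrow> qcomm ((- 1) * (- 1)) (\<psi>' l) (\<psi> j \<otimes> \<psi>' (j + 1))"
      "l \<noteq> j \<Longrightarrow> qcomm ((- 1) * (- 1)) (\<psi> l) (\<psi> (j + 1) \<otimes> \<psi>' j)"
      "l \<noteq> j + 1 \<Longrightarrow> qcomm ((- 1) * (- 1)) (\<psi>' l) (\<psi> (j + 1) \<otimes> \<psi>' j)"
      using l j inner(2) by (intro qcomm_mult_right anticommute generators_closed; simp)+
    then show ?thesis using inner by (auto simp: e_def f_def)
  next
    case last
    have "qcomm (- 1) (\<psi> l) (c \<odot> \<psi> n)" "l \<noteq> n \<Longrightarrow> qcomm (- 1) (\<psi>' l) (c \<odot> \<psi> n)"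
      "l \<noteq> n \<Longrightarrow> qcomm (- 1) (\<psi> l) (\<psi>' n)" "qcomm (- 1) (\<psi>' l) (\<psi>' n)" for c
      using l j last anticommute by (simp_all add: qcomm_smult_right)
    then show ?thesis using last by (auto simp: e_def f_def)
  qed
  then show "l \<noteq> j + 1 \<Longrightarrow> \<exists>s. qcomm s (\<psi> l) (e j)" "l \<noteq> j \<Longrightarrow> \<exists>s. qcomm s (\<psi>' l) (e j)"
    "l \<noteq> j \<Longrightarrow> \<exists>s. qcomm s (\<psi> l) (f j)" "l \<noteq> j + 1 \<Longrightarrow> \<exists>s. qcomm s (\<psi>' l) (f j)"
    by blast+
qed

text \<open>One of the two square-zero factors of \<open>a b\<close> can be carried through \<open>x\<close>: either the left \<open>a\<close> meets
  the right \<open>a\<close>, or the left \<open>b\<close> meets the right \<open>b\<close>.\<close>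

lemma sandwich_zero:
  assumes a: "qcomm s a b" "a \<otimes> a = \<zero>" "b \<otimes> b = \<zero>"
    and x: "(\<exists>t. qcomm t a x) \<or> (\<exists>t. qcomm t b x)"
    and c: "a \<in> carrier B" "b \<in> carrier B" "x \<in> carrier B"
  shows "(a \<otimes> b) \<otimes> (x \<otimes> (a \<otimes> b)) = \<zero>"
  using x
proof (elim disjE exE)
  fix t assume t: "qcomm t a x"
  have "a \<otimes> ((b \<otimes> x) \<otimes> a) = \<zero>"
    using qcomm_sandwich[OF qcomm_mult_right[OF a(1) t]] a c by simp
  moreover have "(a \<otimes> b) \<otimes> (x \<otimes> (a \<otimes> b)) = (a \<otimes> ((b \<otimes> x) \<otimes> a)) \<otimes> b" using c by (simp add: m_assoc)
  ultimately show ?thesis using c by simp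
next
  fix t assume t: "qcomm t b x"
  have bab: "b \<otimes> (a \<otimes> b) = \<zero>"
  proof -
    have "b \<otimes> (a \<otimes> b) = s \<odot> ((b \<otimes> b) \<otimes> a)" using a(1) c by (simp add: qcomm_def smult_mult m_assoc)
    then show ?thesis using a c by simp
  qed
  have "(a \<otimes> b) \<otimes> (x \<otimes> (a \<otimes> b)) = a \<otimes> ((b \<otimes> x) \<otimes> (a \<otimes> b))"
    using c by (simp add: m_assoc)
  also have "b \<otimes> x = t \<odot> (x \<otimes> b)" using t by (simp only: qcomm_def)
  also have "a \<otimes> (t \<odot> (x \<otimes> b) \<otimes> (a \<otimes> b)) = t \<odot> (a \<otimes> (x \<otimes> (b \<otimes> (a \<otimes> b))))"
    using c by (simp add: smult_mult m_assoc)
  finally show ?thesis using c by (simp add: bab)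
qed

lemma e_sandwich:
  assumes i: "i \<in> {1..n}" "i < n" and j: "j \<in> {1..n}" "i \<noteq> j"
  shows "e i \<otimes> (e j \<otimes> e i) = \<zero>" "f i \<otimes> (f j \<otimes> f i) = \<zero>"
proof -
  have i': "i + 1 \<in> {1..n}" using i by simp
  \<comment> \<open>\<open>\<psi> i\<close> clashes only with the letter \<open>\<psi>' (j + 1)\<close> of \<open>e j\<close>, and \<open>\<psi>' (i + 1)\<close> only with \<open>\<psi> j\<close>;
    both cannot happen. The letters of \<open>f\<close> behave in the same way.\<close>
  have ne: "i \<noteq> j + 1 \<or> i + 1 \<noteq> j" by simp
  have "(\<exists>t. qcomm t (\<psi> i) (e j)) \<or> (\<exists>t. qcomm t (\<psi>' (i + 1)) (e j))"
    using ne qcomm_letters(1)[OF i(1) j(1)] qcomm_letters(2)[OF i' j(1)] by blast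
  then have "(\<psi> i \<otimes> \<psi>' (i + 1)) \<otimes> (e j \<otimes> (\<psi> i \<otimes> \<psi>' (i + 1))) = \<zero>"
    using i j i' by (intro sandwich_zero[OF anticommute(3)] squares_zero generators_closed images_closed) auto
  moreover have "(\<exists>t. qcomm t (\<psi> (i + 1)) (f j)) \<or> (\<exists>t. qcomm t (\<psi>' i) (f j))"
    using ne qcomm_letters(3)[OF i' j(1)] qcomm_letters(4)[OF i(1) j(1)] by blast
  then have "(\<psi> (i + 1) \<otimes> \<psi>' i) \<otimes> (f j \<otimes> (\<psi> (i + 1) \<otimes> \<psi>' i)) = \<zero>"
    using i j i' by (intro sandwich_zero[OF anticommute(3)] squares_zero generators_closed images_closed) auto
  ultimately show "e i \<otimes> (e j \<otimes> e i) = \<zero>" "f i \<otimes> (f j \<otimes> f i) = \<zero>"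
    using i by (simp_all add: e_def[of i] f_def[of i])
qed

lemma distant_commute:
  assumes i: "i \<in> {1..n}" and j: "j \<in> {1..n}" and ij: "i + 1 < j \<or> j + 1 < i"
  shows "e i \<otimes> e j = e j \<otimes> e i" "f i \<otimes> f j = f j \<otimes> f i"
proof -
  have *: "e i \<otimes> e j = e j \<otimes> e i \<and> f i \<otimes> f j = f j \<otimes> f i"
    if i: "i \<in> {1..n}" and j: "j \<in> {1..n}" and ij: "i + 1 < j" for i j
  proof -
    have inn: "i < n" "i + 1 \<in> {1..n}" using j ij by auto
    have "qcomm 1 (e i) (e j) \<and> qcomm 1 (f i) (f j)" using j
    proof (cases rule: index_cases)
      case inner
      have "qcomm 1 (\<psi> i \<otimes> \<psi>' (i + 1)) (\<psi> j \<otimes> \<psi>' (j + 1))"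
        "qcomm 1 (\<psi> (i + 1) \<otimes> \<psi>' i) (\<psi> (j + 1) \<otimes> \<psi>' j)"
        using i j ij inn inner(2) by (intro qcomm_pairs anticommute generators_closed; simp)+
      then show ?thesis using inn inner by (simp add: e_def f_def)
    next
      case last
      have "qcomm ((- 1) * (- 1)) (\<psi> i \<otimes> \<psi>' (i + 1)) (\<psi> n)"
        "qcomm ((- 1) * (- 1)) (\<psi> (i + 1) \<otimes> \<psi>' i) (\<psi>' n)"
        using i j ij inn last by (intro qcomm_mult_left anticommute generators_closed; simp)+
      then show ?thesis using i j inn last by (simp add: e_def f_def qcomm_smult_right)
    qed
    then show ?thesis using i j by (simp add: qcomm_def)
  qed
  show "e i \<otimes> e j = e j \<otimes> e i" "f i \<otimes> f j = f j \<otimes> f i"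
    using ij *[OF i j] *[OF j i] by auto
qed

text \<open>The values -1, -2 and 0 of the Cartan entry are those off the diagonal, and they ask for two, three
  and one applications of \<open>adj\<close>. The entry -1 forces \<open>i < n\<close>, where \<open>e i e j e i\<close> vanishes; the entry
  0 forces \<open>i\<close> and \<open>j\<close> to differ by at least two, where \<open>e i\<close> and \<open>e j\<close> commute.\<close>

lemma serre:
  assumes i: "i \<in> {1..n}" and j: "j \<in> {1..n}" and "i \<noteq> j"
  shows "cartan n i j = -1 \<Longrightarrow> adj d (e i) (k i) (k' i) (adj c (e i) (k i) (k' i) (e j)) = \<zero>"
    "cartan n i j = -1 \<Longrightarrow> adj d (f i) (k' i) (k i) (adj c (f i) (k' i) (k i) (f j)) = \<zero>"
    "cartan n i j = -2 \<Longrightarrow> adj b (e i) (k i) (k' i) (adj d (e i) (k i) (k' i) (adj c (e i) (k i) (k' i) (e j))) = \<zero>"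
    "cartan n i j = -2 \<Longrightarrow> adj b (f i) (k' i) (k i) (adj d (f i) (k' i) (k i) (adj c (f i) (k' i) (k i) (f j))) = \<zero>"
    "cartan n i j = 0 \<Longrightarrow> adj 1 (e i) (k i) (k' i) (e j) = \<zero>"
    "cartan n i j = 0 \<Longrightarrow> adj 1 (f i) (k' i) (k i) (f j) = \<zero>"
proof -
  note ks = k_inverse[OF i]
  have q: "qi n i \<noteq> 0" by (simp add: qi_def)
  have f_conj: "k' i \<otimes> f l \<otimes> k i = inverse (qi n i powi (- cartan n i l)) \<odot> f l" if "l \<in> {1..n}" for l
    using conj_inverse[OF k_f[OF i that] _ ks(2)] i that q by simp
  have inn: "i < n" if "cartan n i j = -1"
    using that i j \<open>i \<noteq> j\<close> by (auto simp: cartan_def split: if_splits)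
  show "cartan n i j = -1 \<Longrightarrow> adj d (e i) (k i) (k' i) (adj c (e i) (k i) (k' i) (e j)) = \<zero>"
    using serre_two[OF k_e[OF i i] k_e[OF i j] ks(2)] e_f_square[OF i] e_sandwich[OF i inn j] i j \<open>i \<noteq> j\<close>
    by simp
  show "cartan n i j = -1 \<Longrightarrow> adj d (f i) (k' i) (k i) (adj c (f i) (k' i) (k i) (f j)) = \<zero>"
    using serre_two[OF f_conj[OF i] f_conj[OF j] ks(1)] e_f_square[OF i] e_sandwich[OF i inn j] i j \<open>i \<noteq> j\<close>
    by simp
  show "adj b (e i) (k i) (k' i) (adj d (e i) (k i) (k' i) (adj c (e i) (k i) (k' i) (e j))) = \<zero>"
    using serre_three[OF k_e[OF i i] k_e[OF i j] ks(2)] e_f_square[OF i] i j by simp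
  show "adj b (f i) (k' i) (k i) (adj d (f i) (k' i) (k i) (adj c (f i) (k' i) (k i) (f j))) = \<zero>"
    using serre_three[OF f_conj[OF i] f_conj[OF j] ks(1)] e_f_square[OF i] i j by simp
  assume z: "cartan n i j = 0"
  then have dist: "i + 1 < j \<or> j + 1 < i"
    using \<open>i \<noteq> j\<close> by (auto simp: cartan_def split: if_splits)
  have cancel: "x \<oplus> (- 1) \<odot> x = \<zero>" if "x \<in> carrier B" for x
    using that by (simp flip: minus_eq_smult add: r_neg)
  have "k i \<otimes> e j \<otimes> k' i = 1 \<odot> e j" "k' i \<otimes> f j \<otimes> k i = 1 \<odot> f j"
    using k_e[OF i j] f_conj[OF j] z by simp_all
  note this[THEN adj_eigenvector[where c = 1]]
  then show "adj 1 (e i) (k i) (k' i) (e j) = \<zero>" "adj 1 (f i) (k' i) (k i) (f j) = \<zero>"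
    using i j distant_commute[OF i j dist] cancel by simp_all
qed

end

section \<open>Homogeneity of the relations\<close>

lemma component_free_mult_eq:
  "a \<in> component (free_superalgebra G p) s \<Longrightarrow> b \<in> component (free_superalgebra G p) t \<Longrightarrow> s + t = u
    \<Longrightarrow> a * b \<in> component (free_superalgebra G p) u"
  using component_free_closed(7) by blast

lemma component_free_scal_mult:
  "a \<in> component (free_superalgebra G p) s \<Longrightarrow> scal c * a \<in> component (free_superalgebra G p) s"
  by (rule component_free_mult_eq[OF component_free_closed(3) _ add_0])

lemma component_free_diff:
  "a \<in> component (free_superalgebra G p) s \<Longrightarrow> b \<in> component (free_superalgebra G p) s
    \<Longrightarrow> a - b \<in> component (free_superalgebra G p) s"
  using component_free_closed(5)[of a G p s "- b"] component_free_closed(6)[of b G p s] by simp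

lemma component_free_gen_eq:
  "g \<in> G \<Longrightarrow> p g = s \<Longrightarrow> gen g \<in> component (free_superalgebra G p) s"
  using component_free_closed(4)[of g G p] by simp

lemma koszul_sign_scal: "koszul_sign s t = scal (koszul_sign s t)"
  by (simp add: koszul_sign_def scal_simps)

lemma cgens_simps [simp]:
  "Psi i \<in> cgens n \<longleftrightarrow> i \<in> {1..n}" "PsiD i \<in> cgens n \<longleftrightarrow> i \<in> {1..n}"
  "V i \<in> cgens n \<longleftrightarrow> i \<in> {1..n}" "V' i \<in> cgens n \<longleftrightarrow> i \<in> {1..n}"
  by (auto simp: cgens_def)

lemma ugens_simps [simp]:
  "UE i \<in> ugens n \<longleftrightarrow> i \<in> {1..n}" "UF i \<in> ugens n \<longleftrightarrow> i \<in> {1..n}"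
  "UK i \<in> ugens n \<longleftrightarrow> i \<in> {1..n}" "UK' i \<in> ugens n \<longleftrightarrow> i \<in> {1..n}"
  by (auto simp: ugens_def)

lemmas homogeneous_intros = component_free_diff component_free_closed(1,2,5) component_free_scal_mult
  component_free_mult_eq component_free_gen_eq

lemma crels_homogeneous: "crels n \<subseteq> component (cfree n) 0 \<union> component (cfree n) 1"
proof
  fix a assume "a \<in> crels n"
  then have "\<exists>s. a \<in> component (cfree n) s"
  proof cases
    case (V_Psi i j)
    then have "a \<in> component (cfree n) 1" by (auto intro!: homogeneous_intros)
    then show ?thesis ..
  next
    case (V_PsiD i j)
    then have "a \<in> component (cfree n) 1" by (auto intro!: homogeneous_intros)
    then show ?thesis ..
  qed (rule exI[of _ 0]; auto intro!: homogeneous_intros)+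
  then show "a \<in> component (cfree n) 0 \<union> component (cfree n) 1"
    by (metis (full_types) UnI1 UnI2 bit.exhaust)
qed

text \<open>Up to a scalar both terms of \<open>Ad\<close> are products of the argument with \<open>e\<^sub>i\<close> and even factors, so
  iterating \<open>Ad\<close> preserves homogeneity; this covers the Serre relations, the only relations that
  are not visibly homogeneous.\<close>

lemma Ad_homogeneous:
  assumes i: "i \<in> {1..n}" and a: "a \<in> component (ufree n) s"
  shows "Ad_e n i a \<in> component (ufree n) (upar n (UE i) + s)"
    "Ad_f n i a \<in> component (ufree n) (upar n (UF i) + s)"
  unfolding Ad_e_def Ad_f_def koszul_sign_scal
  using i a by (auto intro!: homogeneous_intros simp: add.commute)

lemma Ad_iterate_homogeneous:
  assumes i: "i \<in> {1..n}" and j: "j \<in> {1..n}"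
  shows "\<exists>s. (Ad_e n i ^^ m) (gen (UE j)) \<in> component (ufree n) s"
    "\<exists>s. (Ad_f n i ^^ m) (gen (UF j)) \<in> component (ufree n) s"
proof -
  show "\<exists>s. (Ad_e n i ^^ m) (gen (UE j)) \<in> component (ufree n) s"
  proof (induction m)
    case 0
    then show ?case using component_free_gen_eq[of "UE j" "ugens n"] j by auto
  next
    case (Suc m)
    then show ?case using Ad_homogeneous(1)[OF i] by auto
  qed
  show "\<exists>s. (Ad_f n i ^^ m) (gen (UF j)) \<in> component (ufree n) s"
  proof (induction m)
    case 0
    then show ?case using component_free_gen_eq[of "UF j" "ugens n"] j by auto
  next
    case (Suc m)
    then show ?case using Ad_homogeneous(2)[OF i] by auto
  qed
qed

lemma urels_homogeneous: "urels n \<subseteq> component (ufree n) 0 \<union> component (ufree n) 1"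
proof
  fix a assume "a \<in> urels n"
  then have "\<exists>s. a \<in> component (ufree n) s"
  proof cases
    case (K_E i j)
    then have "a \<in> component (ufree n) (upar n (UE j))" by (auto intro!: homogeneous_intros)
    then show ?thesis ..
  next
    case (K_F i j)
    then have "a \<in> component (ufree n) (upar n (UF j))" by (auto intro!: homogeneous_intros)
    then show ?thesis ..
  next
    case (E_F i j)
    have "a \<in> component (ufree n) (upar n (UE i) + upar n (UF j))"
      unfolding E_F koszul_sign_scal using E_F(2,3)
      by (auto intro!: homogeneous_intros simp: add.commute)
    then show ?thesis ..
  next
    case (Serre_E i j)
    then show ?thesis using Ad_iterate_homogeneous by blast
  next
    case (Serre_F i j)
    then show ?thesis using Ad_iterate_homogeneous by blast
  qed (rule exI[of _ 0]; auto intro!: homogeneous_intros)+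
  then show "a \<in> component (ufree n) 0 \<union> component (ufree n) 1"
    by (metis (full_types) UnI1 UnI2 bit.exhaust)
qed

lemma clifford_relations: "homogeneous_relations ground_field (cfree n) (crels n)"
  by (intro homogeneous_relations.intro homogeneous_relations_axioms.intro superalgebra_free crels_homogeneous)

lemma osp_relations: "homogeneous_relations ground_field (ufree n) (urels n)"
  by (intro homogeneous_relations.intro homogeneous_relations_axioms.intro superalgebra_free urels_homogeneous)

lemma (in homogeneous_relations) coset_relation: "s \<in> S \<Longrightarrow> I +>\<^bsub>A\<^esub> s = \<zero>\<^bsub>Q\<^esub>"
proof -
  assume s: "s \<in> S"
  then have "s \<in> I" "s \<in> carrier A" using genideal_self[OF gens_subset] gens_subset by auto
  then show ?thesis unfolding zero_Q by (subst coset_eq_iff) (auto simp: a_minus_def)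
qed

section \<open>The deformed Clifford algebra\<close>

text \<open>These rules evaluate a homomorphism on a relation; applied to the projection onto a quotient, they
  turn each element \<open>l - r\<close> of a set of relations into the equation that it represents.\<close>

lemma superalgebra_hom_free_simps:
  assumes "superalgebra_hom ground_field (free_superalgebra G p) B h"
  shows "x \<in> free_carrier G \<Longrightarrow> h x \<in> carrier B"
    and "x \<in> free_carrier G \<Longrightarrow> y \<in> free_carrier G \<Longrightarrow> h (x * y) = h x \<otimes>\<^bsub>B\<^esub> h y"
    and "x \<in> free_carrier G \<Longrightarrow> y \<in> free_carrier G \<Longrightarrow> h (x + y) = h x \<oplus>\<^bsub>B\<^esub> h y"
    and "x \<in> free_carrier G \<Longrightarrow> y \<in> free_carrier G \<Longrightarrow> h (x - y) = \<zero>\<^bsub>B\<^esub> \<Longrightarrow> h x = h y"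
    and "h 1 = \<one>\<^bsub>B\<^esub>"
    and "z \<in> carrier B \<Longrightarrow> h (scal c) \<otimes>\<^bsub>B\<^esub> z = c \<odot>\<^bsub>B\<^esub> z"
proof -
  interpret h: superalgebra_hom ground_field "free_superalgebra G p" B h by fact
  show closed: "h x \<in> carrier B" if "x \<in> free_carrier G" for x
    using ring_hom_closed[OF h.ring_hom, of x] that by simp
  show "x \<in> free_carrier G \<Longrightarrow> y \<in> free_carrier G \<Longrightarrow> h (x * y) = h x \<otimes>\<^bsub>B\<^esub> h y"
    using ring_hom_mult[OF h.ring_hom, of x y] by simp
  show add: "h (x + y) = h x \<oplus>\<^bsub>B\<^esub> h y" if "x \<in> free_carrier G" "y \<in> free_carrier G" for x y
    using ring_hom_add[OF h.ring_hom, of x y] that by simp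
  show "h x = h y" if "x \<in> free_carrier G" "y \<in> free_carrier G" "h (x - y) = \<zero>\<^bsub>B\<^esub>"
    using add[of "x - y" y] closed[of y] that by simp
  show one: "h 1 = \<one>\<^bsub>B\<^esub>" using ring_hom_one[OF h.ring_hom] by simp
  have smult: "h (scal c * x) = c \<odot>\<^bsub>B\<^esub> h x" if "x \<in> free_carrier G" for x
    using h.linear[of c x] that by simp
  show "h (scal c) \<otimes>\<^bsub>B\<^esub> z = c \<odot>\<^bsub>B\<^esub> z" if "z \<in> carrier B"
    using smult[of 1] one that h.cod.smult_mult_left[of c "\<one>\<^bsub>B\<^esub>" z] by simp
qed

lemma clifford_generators_Clq: "clifford_generators (Clq n) n (psi n) (psi_dag n) (v_gen n) (v_inv n)"
proof -
  interpret C: homogeneous_relations ground_field "cfree n" "crels n" by (rule clifford_relations)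
  let ?h = "\<lambda>x. cideal n +>\<^bsub>cfree n\<^esub> x"
  have h: "superalgebra_hom ground_field (cfree n) (Clq n) ?h"
    using C.projection_hom by (simp add: Clq_def cideal_def)
  then interpret h: superalgebra_hom ground_field "cfree n" "Clq n" ?h .
  note hom = superalgebra_hom_free_simps[OF h]
  have rel0: "?h a = \<zero>\<^bsub>Clq n\<^esub>" if "a \<in> crels n" for a
    using C.coset_relation[OF that] by (simp add: Clq_def cideal_def)
  have rel: "?h a = ?h b" if "a - b \<in> crels n" "a \<in> free_carrier (cgens n)" "b \<in> free_carrier (cgens n)" for a b
    using hom(4)[OF that(2,3) rel0[OF that(1)]] .
  have g: "gen (Psi i) \<in> free_carrier (cgens n)" "gen (PsiD i) \<in> free_carrier (cgens n)"
    "gen (V i) \<in> free_carrier (cgens n)" "gen (V' i) \<in> free_carrier (cgens n)" if "i \<in> {1..n}" for i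
    using that by auto
  note defs = psi_def psi_dag_def v_gen_def v_inv_def
  note ev = hom(1,2,3,5,6) h.cod.m_closed g free_carrier_closed(1-3,5-7)
  show ?thesis
  proof (intro clifford_generators.intro clifford_generators_axioms.intro ratfun_superalgebra.intro
      h.cod.superalgebra_axioms)
    fix i assume i: "i \<in> {1..n}"
    have "gen (Psi i) \<in> component (cfree n) 1" "gen (PsiD i) \<in> component (cfree n) 1"
      "gen (V i) \<in> component (cfree n) 0" "gen (V' i) \<in> component (cfree n) 0"
      using i by (auto intro!: component_free_gen_eq)
    then show "psi n i \<in> component (Clq n) 1" "psi_dag n i \<in> component (Clq n) 1"
      "v_gen n i \<in> component (Clq n) 0" "v_inv n i \<in> component (Clq n) 0"
      unfolding defs by (auto intro: h.preserves_parity)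
    show "v_gen n i \<otimes>\<^bsub>Clq n\<^esub> v_inv n i = \<one>\<^bsub>Clq n\<^esub>"
      using rel[OF V_inv1[OF i]] i unfolding defs by (simp only: ev simp_thms)
    show "v_inv n i \<otimes>\<^bsub>Clq n\<^esub> v_gen n i = \<one>\<^bsub>Clq n\<^esub>"
      using rel[OF V_inv2[OF i]] i unfolding defs by (simp only: ev simp_thms)
    show "psi n i \<otimes>\<^bsub>Clq n\<^esub> psi_dag n i \<oplus>\<^bsub>Clq n\<^esub> qq \<odot>\<^bsub>Clq n\<^esub> (psi_dag n i \<otimes>\<^bsub>Clq n\<^esub> psi n i)
        = v_inv n i"
      using rel[OF Psi_PsiD_q[OF i]] i unfolding defs by (simp only: ev simp_thms)
    show "psi n i \<otimes>\<^bsub>Clq n\<^esub> psi_dag n i \<oplus>\<^bsub>Clq n\<^esub> inverse qq \<odot>\<^bsub>Clq n\<^esub> (psi_dag n i \<otimes>\<^bsub>Clq n\<^esub> psi n i)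
        = v_gen n i"
      using rel[OF Psi_PsiD_q_inv[OF i]] i unfolding defs by (simp only: ev simp_thms)
    fix j assume j: "j \<in> {1..n}"
    show "v_gen n i \<otimes>\<^bsub>Clq n\<^esub> v_gen n j = v_gen n j \<otimes>\<^bsub>Clq n\<^esub> v_gen n i"
      using rel[OF V_comm[OF i j]] i j unfolding defs by (simp only: ev simp_thms)
    show "v_gen n i \<otimes>\<^bsub>Clq n\<^esub> psi n j \<otimes>\<^bsub>Clq n\<^esub> v_inv n i
        = (qq powi (if i = j then 1 else 0)) \<odot>\<^bsub>Clq n\<^esub> psi n j"
      using rel[OF V_Psi[OF i j]] i j unfolding defs by (simp only: ev simp_thms)
    show "v_gen n i \<otimes>\<^bsub>Clq n\<^esub> psi_dag n j \<otimes>\<^bsub>Clq n\<^esub> v_inv n i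
        = (qq powi (- (if i = j then 1 else 0))) \<odot>\<^bsub>Clq n\<^esub> psi_dag n j"
      using rel[OF V_PsiD[OF i j]] i j unfolding defs by (simp only: ev simp_thms)
    show "psi n i \<otimes>\<^bsub>Clq n\<^esub> psi n j \<oplus>\<^bsub>Clq n\<^esub> psi n j \<otimes>\<^bsub>Clq n\<^esub> psi n i = \<zero>\<^bsub>Clq n\<^esub>"
      using rel0[OF Psi_Psi[OF i j]] i j unfolding defs by (simp only: ev simp_thms)
    show "psi_dag n i \<otimes>\<^bsub>Clq n\<^esub> psi_dag n j \<oplus>\<^bsub>Clq n\<^esub> psi_dag n j \<otimes>\<^bsub>Clq n\<^esub> psi_dag n i = \<zero>\<^bsub>Clq n\<^esub>"
      using rel0[OF PsiD_PsiD[OF i j]] i j unfolding defs by (simp only: ev simp_thms)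
    assume "i \<noteq> j"
    show "psi n i \<otimes>\<^bsub>Clq n\<^esub> psi_dag n j \<oplus>\<^bsub>Clq n\<^esub> psi_dag n j \<otimes>\<^bsub>Clq n\<^esub> psi n i = \<zero>\<^bsub>Clq n\<^esub>"
      using rel0[OF Psi_PsiD[OF i j \<open>i \<noteq> j\<close>]] i j unfolding defs by (simp only: ev simp_thms)
  qed
qed

section \<open>The homomorphism from the quantum supergroup\<close>

lemma cartan_off_diagonal: "i \<noteq> j \<Longrightarrow> cartan n i j = -1 \<or> cartan n i j = -2 \<or> cartan n i j = 0"
  by (simp add: cartan_def)

lemma parity_gen: "g \<in> ugens n \<Longrightarrow> parity (ufree n) (gen g) = upar n g"
  by (auto simp: parity_def component_free gen_def word_parity_def free_carrier_def)

lemma (in graded_assignment) free_lift_scal_left: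
  "z \<in> carrier B \<Longrightarrow> free_lift B \<phi> (scal c) \<otimes>\<^bsub>B\<^esub> z = c \<odot>\<^bsub>B\<^esub> z"
  using smult_mult_left[of c "\<one>\<^bsub>B\<^esub>" z] by (simp add: free_lift_scal)

lemma (in graded_assignment) free_lift_diff:
  "free_lift B \<phi> (a - b) = free_lift B \<phi> a \<ominus>\<^bsub>B\<^esub> free_lift B \<phi> b"
proof -
  have "free_lift B \<phi> a = free_lift B \<phi> (a - b) \<oplus>\<^bsub>B\<^esub> free_lift B \<phi> b"
    by (simp flip: free_lift_add)
  then show ?thesis by (simp add: a_minus_def a_assoc r_neg)
qed

context clifford_generators
begin

fun assignment :: "ugen \<Rightarrow> 'b" where
  "assignment (UE i) = (if i \<in> {1..n} then e i else \<zero>)"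
| "assignment (UF i) = (if i \<in> {1..n} then f i else \<zero>)"
| "assignment (UK i) = (if i \<in> {1..n} then k i else \<zero>)"
| "assignment (UK' i) = (if i \<in> {1..n} then k' i else \<zero>)"

lemma graded_assignment: "graded_assignment B (upar n) assignment"
proof (intro graded_assignment.intro graded_assignment_axioms.intro superalgebra_axioms)
  fix g show "assignment g \<in> component B (upar n g)"
    using images_parity component_zero by (cases g) auto
qed

abbreviation \<Phi> :: "ugen free_alg \<Rightarrow> 'b" where
  "\<Phi> \<equiv> free_lift B assignment"

text \<open>The lift turns \<open>Ad\<close> into \<open>adj\<close> with some sign as its scalar. The value of this sign matters only
  for a single application of \<open>adj\<close>, where the argument is a generator: \<open>i \<noteq> j\<close> implies that one of
  \<open>e\<^sub>i\<close>, \<open>e\<^sub>j\<close> is even, so the sign is 1.\<close>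

lemma \<Phi>_relation:
  assumes "a \<in> urels n" shows "\<Phi> a = \<zero>"
proof -
  interpret \<Phi>: graded_assignment B "upar n" assignment by (rule graded_assignment)
  note ev = \<Phi>.free_lift_scal_left m_closed images_closed \<Phi>.free_lift_closed \<Phi>.free_lift_mult \<Phi>.free_lift_diff \<Phi>.free_lift_gen koszul_sign_scal
  have one: "\<Phi> 1 = \<one>" using \<Phi>.free_lift_scal[of 1] by (simp add: scal_simps)
  have Ad_e: "\<Phi> (Ad_e n i x) = adj (koszul_sign (parity (ufree n) (gen (UE i))) (parity (ufree n) x))
      (e i) (k i) (k' i) (\<Phi> x)"
    and Ad_f: "\<Phi> (Ad_f n i x) = adj (koszul_sign (parity (ufree n) (gen (UF i))) (parity (ufree n) x))
      (f i) (k' i) (k i) (\<Phi> x)" if "i \<in> {1..n}" for i x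
    using that by (simp_all only: Ad_e_def Ad_f_def adj_def ev assignment.simps if_True)
  have eq: "x \<ominus> y = \<zero>" if "x = y" "y \<in> carrier B" for x y using that by (simp add: a_minus_def r_neg)
  show ?thesis using assms
  proof cases
    case (K_inv1 i)
    then show ?thesis using k_inverse by (simp add: ev one eq)
  next
    case (K_inv2 i)
    then show ?thesis using k_inverse by (simp add: ev one eq)
  next
    case (K_comm i j)
    then show ?thesis using k_comm[of i j] by (simp add: ev eq)
  next
    case (K_E i j)
    then show ?thesis using k_e[of i j] by (simp add: ev eq)
  next
    case (K_F i j)
    then show ?thesis using k_f[of i j] by (simp add: ev eq)
  next
    case (E_F i j)
    have par: "parity (ufree n) (gen (UE i)) = (if i = n then 1 else 0)"
      "parity (ufree n) (gen (UF j)) = (if j = n then 1 else 0)"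
      using E_F by (simp_all add: parity_gen)
    show ?thesis
    proof (cases "i = j")
      case False
      then have "koszul_sign (if i = n then 1 else 0) (if j = n then 1 else 0) = (1 :: ugen free_alg)"
        by (auto simp: koszul_sign_def)
      moreover have "e i \<otimes> f j = f j \<otimes> e i"
        using qcomm_e_f[OF E_F(2,3) False] E_F(2,3) by (simp add: qcomm_def)
      ultimately show ?thesis unfolding E_F(1) par using False E_F(2,3) by (simp add: ev eq)
    next
      case ij: True
      show ?thesis
      proof (cases "i = n")
        case True
        have "koszul_sign (if i = n then 1 else 0) (if j = n then 1 else 0) = (scal (- 1) :: ugen free_alg)"
          using True ij by (simp add: koszul_sign_def scal_simps)
        then show ?thesis unfolding E_F(1) par using True ij E_F(2,3) e_f_last
          by (simp add: ev eq diff_eq_smult smult_smult)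
      next
        case False
        then have "koszul_sign (if i = n then 1 else 0) (if j = n then 1 else 0) = (1 :: ugen free_alg)"
          by (auto simp: koszul_sign_def)
        then show ?thesis unfolding E_F(1) par using False ij E_F(2,3) e_f_inner[of i]
          by (simp add: ev eq)
      qed
    qed
  next
    case (Serre_E i j)
    have sgn: "koszul_sign (parity (ufree n) (gen (UE i))) (parity (ufree n) (gen (UE j))) = (1 :: ratfun)"
      using Serre_E by (auto simp: parity_gen koszul_sign_def)
    have base: "\<Phi> (gen (UE j)) = e j" using Serre_E by (simp add: ev)
    consider "cartan n i j = -1" | "cartan n i j = -2" | "cartan n i j = 0"
      using cartan_off_diagonal[OF \<open>i \<noteq> j\<close>] by blast
    then show ?thesis
      by cases (use serre[OF Serre_E(2-4)] Serre_E sgn in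
          \<open>simp_all add: eval_nat_numeral Ad_e base\<close>)
  next
    case (Serre_F i j)
    have sgn: "koszul_sign (parity (ufree n) (gen (UF i))) (parity (ufree n) (gen (UF j))) = (1 :: ratfun)"
      using Serre_F by (auto simp: parity_gen koszul_sign_def)
    have base: "\<Phi> (gen (UF j)) = f j" using Serre_F by (simp add: ev)
    consider "cartan n i j = -1" | "cartan n i j = -2" | "cartan n i j = 0"
      using cartan_off_diagonal[OF \<open>i \<noteq> j\<close>] by blast
    then show ?thesis
      by cases (use serre[OF Serre_F(2-4)] Serre_F sgn in
          \<open>simp_all add: eval_nat_numeral Ad_f base\<close>)
  qed
qed

theorem osp_hom_exists:
  "\<exists>\<pi> \<in> extensional (carrier (Uq_osp n)). superalgebra_hom ground_field (Uq_osp n) B \<pi> \<and>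
    (\<forall>i \<in> {1..n}. \<pi> (e_gen n i) = e i \<and> \<pi> (f_gen n i) = f i \<and> \<pi> (k_gen n i) = k i)"
proof -
  interpret \<Phi>: graded_assignment B "upar n" assignment by (rule graded_assignment)
  interpret U: homogeneous_relations ground_field "ufree n" "urels n" by (rule osp_relations)
  obtain \<pi> where "\<pi> \<in> extensional (carrier (Uq_osp n))" "superalgebra_hom ground_field (Uq_osp n) B \<pi>"
    and \<pi>: "\<And>x. x \<in> free_carrier (ugens n) \<Longrightarrow> \<pi> (uideal n +>\<^bsub>ufree n\<^esub> x) = \<Phi> x"
    using U.quotient_universal[OF \<Phi>.free_lift_hom \<Phi>_relation] by (auto simp: Uq_osp_def uideal_def)
  moreover have "\<pi> (e_gen n i) = e i \<and> \<pi> (f_gen n i) = f i \<and> \<pi> (k_gen n i) = k i" if "i \<in> {1..n}" for i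
    using that \<pi>[of "gen (UE i)"] \<pi>[of "gen (UF i)"] \<pi>[of "gen (UK i)"]
    by (simp add: e_gen_def f_gen_def k_gen_def \<Phi>.free_lift_gen)
  ultimately show ?thesis by blast
qed

end

lemma superalgebra_hom_comp:
  assumes "superalgebra_hom R A B h" "superalgebra_hom R B C g"
  shows "superalgebra_hom R A C (g \<circ> h)"
proof -
  interpret h: superalgebra_hom R A B h by fact
  interpret g: superalgebra_hom R B C g by fact
  show ?thesis
  proof (intro superalgebra_hom.intro superalgebra_hom_axioms.intro h.dom.superalgebra_axioms g.cod.superalgebra_axioms)
    show "g \<circ> h \<in> ring_hom A C" using ring_hom_trans[OF h.ring_hom g.ring_hom] .
    show "(g \<circ> h) (c \<odot>\<^bsub>A\<^esub> x) = c \<odot>\<^bsub>C\<^esub> (g \<circ> h) x" if "c \<in> carrier R" "x \<in> carrier A" for c x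
      using that h.linear g.linear ring_hom_closed[OF h.ring_hom] by simp
    show "(g \<circ> h) x \<in> component C s" if "x \<in> component A s" for x s
      using that h.preserves_parity g.preserves_parity by simp
  qed
qed

text \<open>Pulled back to the free superalgebra, two such homomorphisms agree on all generators: on the formal
  inverse of \<open>k\<^sub>i\<close> because inverses in a ring are unique.\<close>

lemma osp_hom_eqI:
  assumes \<pi>: "superalgebra_hom ground_field (Uq_osp n) B \<pi>" "\<pi> \<in> extensional (carrier (Uq_osp n))"
    and \<rho>: "superalgebra_hom ground_field (Uq_osp n) B \<rho>" "\<rho> \<in> extensional (carrier (Uq_osp n))"
    and eq: "\<And>i. i \<in> {1..n} \<Longrightarrow> \<pi> (e_gen n i) = \<rho> (e_gen n i)"
      "\<And>i. i \<in> {1..n} \<Longrightarrow> \<pi> (f_gen n i) = \<rho> (f_gen n i)"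
      "\<And>i. i \<in> {1..n} \<Longrightarrow> \<pi> (k_gen n i) = \<rho> (k_gen n i)"
  shows "\<pi> = \<rho>"
proof -
  interpret U: homogeneous_relations ground_field "ufree n" "urels n" by (rule osp_relations)
  interpret \<pi>: superalgebra_hom ground_field "Uq_osp n" B \<pi> by fact
  let ?p = "\<lambda>x. uideal n +>\<^bsub>ufree n\<^esub> x"
  have p: "superalgebra_hom ground_field (ufree n) (Uq_osp n) ?p"
    using U.projection_hom by (simp add: Uq_osp_def uideal_def)
  have h: "superalgebra_hom ground_field (ufree n) B (\<pi> \<circ> ?p)" "superalgebra_hom ground_field (ufree n) B (\<rho> \<circ> ?p)"
    using superalgebra_hom_comp[OF p] \<pi>(1) \<rho>(1) by blast+
  note hs1 = superalgebra_hom_free_simps[OF h(1)]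
  note hs2 = superalgebra_hom_free_simps[OF h(2)]
  have inv: "(\<pi> \<circ> ?p) (gen (UK' i)) = (\<rho> \<circ> ?p) (gen (UK' i))" if i: "i \<in> {1..n}" for i
  proof -
    have g: "gen (UK i) \<in> free_carrier (ugens n)" "gen (UK' i) \<in> free_carrier (ugens n)" using i by auto
    have p0: "?p a = \<zero>\<^bsub>Uq_osp n\<^esub>" if "a \<in> urels n" for a
      using U.coset_relation[OF that] by (simp add: Uq_osp_def uideal_def)
    have rel: "?p (gen (UK i) * gen (UK' i)) = ?p 1" "?p (gen (UK' i) * gen (UK i)) = ?p 1"
      by (rule superalgebra_hom_free_simps(4)[OF p _ _ p0[OF K_inv1[OF i]]]
          superalgebra_hom_free_simps(4)[OF p _ _ p0[OF K_inv2[OF i]]];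
          use g in simp)+
    let ?a = "(\<pi> \<circ> ?p) (gen (UK i))" and ?b = "(\<pi> \<circ> ?p) (gen (UK' i))" and ?c = "(\<rho> \<circ> ?p) (gen (UK' i))"
    have ba: "?b \<otimes>\<^bsub>B\<^esub> ?a = \<one>\<^bsub>B\<^esub>"
      using hs1(2)[OF g(2,1)] hs1(5) rel by simp
    have a: "?a = (\<rho> \<circ> ?p) (gen (UK i))" using eq(3)[OF i] by (simp add: k_gen_def)
    have ac: "?a \<otimes>\<^bsub>B\<^esub> ?c = \<one>\<^bsub>B\<^esub>"
      unfolding a using hs2(2)[OF g] hs2(5) rel by simp
    show ?thesis using \<pi>.cod.inv_unique[OF ba ac] hs1(1) hs2(1) g by simp
  qed
  have "(\<pi> \<circ> ?p) (gen g) = (\<rho> \<circ> ?p) (gen g)" if "g \<in> ugens n" for g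
    using that eq inv by (cases g) (auto simp: e_gen_def f_gen_def k_gen_def)
  then have agree: "(\<pi> \<circ> ?p) a = (\<rho> \<circ> ?p) a" if "a \<in> free_carrier (ugens n)" for a
    using superalgebra_hom_free_eqI[OF h] that by blast
  show ?thesis
  proof (rule extensionalityI[OF \<pi>(2) \<rho>(2)])
    fix x assume "x \<in> carrier (Uq_osp n)"
    then obtain a where "a \<in> free_carrier (ugens n)" "x = ?p a"
      using U.carrier_Q by (auto simp: Uq_osp_def uideal_def)
    then show "\<pi> x = \<rho> x" using agree by simp
  qed
qed

theorem theorem2p5:
  fixes n :: nat
  assumes "n \<ge> 1"
  shows "\<exists>!\<pi>. \<pi> \<in> extensional (carrier (Uq_osp n)) \<and>
    superalgebra_hom ground_field (Uq_osp n) (Clq n) \<pi> \<and>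
    (\<forall>i \<in> {1..n - 1}.
      \<pi> (e_gen n i) = psi n i \<otimes>\<^bsub>Clq n\<^esub> psi_dag n (i + 1) \<and>
      \<pi> (f_gen n i) = psi n (i + 1) \<otimes>\<^bsub>Clq n\<^esub> psi_dag n i \<and>
      \<pi> (k_gen n i) = v_gen n i \<otimes>\<^bsub>Clq n\<^esub> v_inv n (i + 1)) \<and>
    \<pi> (e_gen n n) = (imag_unit * inverse (qh - inverse qh)) \<odot>\<^bsub>Clq n\<^esub> psi n n \<and>
    \<pi> (f_gen n n) = psi_dag n n \<and>
    \<pi> (k_gen n n) = (imag_unit * qh) \<odot>\<^bsub>Clq n\<^esub> v_gen n n"
proof -
  interpret C: clifford_generators "Clq n" n "psi n" "psi_dag n" "v_gen n" "v_inv n"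
    by (rule clifford_generators_Clq)
  \<comment> \<open>The prescribed values are those of the uniform families \<open>e\<close>, \<open>f\<close>, \<open>k\<close> at the indices \<open>1, ..., n\<close>.\<close>
  have values_iff: "(\<forall>i \<in> {1..n - 1}.
      \<pi> (e_gen n i) = psi n i \<otimes>\<^bsub>Clq n\<^esub> psi_dag n (i + 1) \<and>
      \<pi> (f_gen n i) = psi n (i + 1) \<otimes>\<^bsub>Clq n\<^esub> psi_dag n i \<and>
      \<pi> (k_gen n i) = v_gen n i \<otimes>\<^bsub>Clq n\<^esub> v_inv n (i + 1)) \<and>
    \<pi> (e_gen n n) = (imag_unit * inverse (qh - inverse qh)) \<odot>\<^bsub>Clq n\<^esub> psi n n \<and>
    \<pi> (f_gen n n) = psi_dag n n \<and>
    \<pi> (k_gen n n) = (imag_unit * qh) \<odot>\<^bsub>Clq n\<^esub> v_gen n n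
    \<longleftrightarrow> (\<forall>i \<in> {1..n}. \<pi> (e_gen n i) = C.e i \<and> \<pi> (f_gen n i) = C.f i \<and> \<pi> (k_gen n i) = C.k i)"
    for \<pi>
  proof -
    have split: "{1..n} = insert n {1..n - 1}" using assms by auto
    have "i < n" if "i \<in> {1..n - 1}" for i using that by auto
    then show ?thesis unfolding split by (auto simp: C.e_def C.f_def C.k_def)
  qed
  show ?thesis
    unfolding values_iff
  proof (rule ex_ex1I)
    show "\<exists>\<pi>. \<pi> \<in> extensional (carrier (Uq_osp n)) \<and> superalgebra_hom ground_field (Uq_osp n) (Clq n) \<pi> \<and>
      (\<forall>i \<in> {1..n}. \<pi> (e_gen n i) = C.e i \<and> \<pi> (f_gen n i) = C.f i \<and> \<pi> (k_gen n i) = C.k i)"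
      using C.osp_hom_exists by blast
  next
    fix \<pi> \<rho>
    assume "\<pi> \<in> extensional (carrier (Uq_osp n)) \<and> superalgebra_hom ground_field (Uq_osp n) (Clq n) \<pi> \<and>
      (\<forall>i \<in> {1..n}. \<pi> (e_gen n i) = C.e i \<and> \<pi> (f_gen n i) = C.f i \<and> \<pi> (k_gen n i) = C.k i)"
      "\<rho> \<in> extensional (carrier (Uq_osp n)) \<and> superalgebra_hom ground_field (Uq_osp n) (Clq n) \<rho> \<and>
      (\<forall>i \<in> {1..n}. \<rho> (e_gen n i) = C.e i \<and> \<rho> (f_gen n i) = C.f i \<and> \<rho> (k_gen n i) = C.k i)"
    then show "\<pi> = \<rho>" by (intro osp_hom_eqI) auto
  qed
qed

end
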